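(* Let $1<\alpha<2$. Suppose $u\in C^{[\alpha]+3}(\mathbb{R})$ and all the derivatives of $u$ up to order $[\alpha]+4$ exist and belong to $L_1(\mathbb{R})$. For $h>0$ let $$ {}^{L}\mathcal{B}_{2}^{\alpha}u(x)=\frac{1}{h^{\alpha}}\sum_{\ell=0}^{\infty}\kappa_{2,\ell}^{(\alpha)}\,u\bigl(x-(\ell-1)h\bigr),$$ where $\kappa_{2,\ell}^{(\alpha)}$ ($\ell=0,1,\ldots$) are the coefficients of the generating function $$\widetilde W_2(z)=\left(\frac{3\alpha-2}{2\alpha}-\frac{2(\alpha-1)}{\alpha}z+\frac{\alpha-2}{2\alpha}z^2\right)^{\alpha}=\sum_{\ell=0}^{\infty}\kappa_{2,\ell}^{(\alpha)}z^{\ell},\qquad |z|<1.$$ Then $$ {}_{RL}D_{-\infty,x}^{\alpha}u(x)={}^{L}\mathcal{B}_{2}^{\alpha}u(x)+\mathcal{O}(h^2)\quad\text{as } h\to 0 .$$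
   Context: $[\alpha]$ denotes the integer part of $\alpha$ (so $[\alpha]=1$ for $1<\alpha<2$). The left Liouville (Riemann-Liouville with lower terminal $-\infty$) derivative of order $\alpha\in(1,2)$ is $$ {}_{RL}D_{-\infty,x}^{\alpha}u(x)=\frac{1}{\Gamma(2-\alpha)}\frac{d^2}{dx^2}\int_{-\infty}^{x}\frac{u(s)\,ds}{(x-s)^{\alpha-1}}.$$ The power $(\cdot)^\alpha$ in the generating function is the branch, analytic in $|z|<1$, whose value at $z=0$ is the positive real number $\left(\frac{3\alpha-2}{2\alpha}\right)^{\alpha}$; the $\kappa_{2,\ell}^{(\alpha)}$ are its Taylor coefficients at $0$. *)

theory Defs
  imports "HOL-Analysis.Analysis" "HOL-Complex_Analysis.Complex_Analysis"
begin

definition Ck_real :: "nat \<Rightarrow> (real \<Rightarrow> real) \<Rightarrow> bool" where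
  "Ck_real k u \<longleftrightarrow>
     (\<forall>j<k. \<forall>x. (deriv ^^ j) u field_differentiable at x) \<and> continuous_on UNIV ((deriv ^^ k) u)"

definition liouville_integral :: "real \<Rightarrow> (real \<Rightarrow> real) \<Rightarrow> real \<Rightarrow> real" where
  "liouville_integral \<alpha> u x = (LINT s:{..<x}|lborel. u s / (x - s) powr (\<alpha> - 1))"

definition RL_deriv :: "real \<Rightarrow> (real \<Rightarrow> real) \<Rightarrow> real \<Rightarrow> real" where
  "RL_deriv \<alpha> u x = 1 / Gamma (2 - \<alpha>) * (deriv ^^ 2) (liouville_integral \<alpha> u) x"

text \<open>The integral and \<^const>\<open>deriv\<close> are total operations, so \<^const>\<open>RL_deriv\<close> has a value for every
  function; the next predicate says that this value is a genuine one everywhere.\<close>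

definition RL_deriv_exists :: "real \<Rightarrow> (real \<Rightarrow> real) \<Rightarrow> bool" where
  "RL_deriv_exists \<alpha> u \<longleftrightarrow>
     (\<forall>x. set_integrable lborel {..<x} (\<lambda>s. u s / (x - s) powr (\<alpha> - 1)) \<and>
          liouville_integral \<alpha> u field_differentiable at x \<and>
          deriv (liouville_integral \<alpha> u) field_differentiable at x)"

definition gen_poly :: "real \<Rightarrow> complex \<Rightarrow> complex" where
  "gen_poly \<alpha> z = of_real ((3 * \<alpha> - 2) / (2 * \<alpha>)) - of_real (2 * (\<alpha> - 1) / \<alpha>) * z
                     + of_real ((\<alpha> - 2) / (2 * \<alpha>)) * z ^ 2"

text \<open>The power is the principal one. On the unit disc the polynomial avoids the branch cut, so this is
  the holomorphic branch that is a positive real number at the origin (\<open>W2_holomorphic\<close> and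
  \<open>W2_at_0\<close> below).\<close>

definition W2 :: "real \<Rightarrow> complex \<Rightarrow> complex" where
  "W2 \<alpha> z = gen_poly \<alpha> z powr of_real \<alpha>"

text \<open>The Taylor coefficients are real, so taking real parts loses nothing (\<open>W2_sums\<close> below).\<close>

definition kappa2 :: "real \<Rightarrow> nat \<Rightarrow> real" where
  "kappa2 \<alpha> l = Re (fps_nth (fps_expansion (W2 \<alpha>) 0) l)"

definition B2 :: "real \<Rightarrow> real \<Rightarrow> (real \<Rightarrow> real) \<Rightarrow> real \<Rightarrow> real" where
  "B2 \<alpha> h u x = 1 / h powr \<alpha> * (\<Sum>l. kappa2 \<alpha> l * u (x - (real l - 1) * h))"

lemma gen_poly_not_nonpos:
  assumes "1 < \<alpha>" "\<alpha> < 2" "norm z < 1"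
  shows "gen_poly \<alpha> z \<notin> \<real>\<^sub>\<le>\<^sub>0"
proof
  define c where "c = (2 - \<alpha>) / (2 * \<alpha>)"
  have c: "0 < c" "c < 1 / 2" using assms by (auto simp: c_def field_simps)
  define v where "v = 1 - z"
  define w where "w = of_real (1 - c) + of_real c * z"
  have coeffs: "(3 * \<alpha> - 2) / (2 * \<alpha>) = 1 - c" "2 * (\<alpha> - 1) / \<alpha> = 1 - 2 * c" "(\<alpha> - 2) / (2 * \<alpha>) = - c"
    using assms by (auto simp: c_def field_simps)
  have eq: "gen_poly \<alpha> z = v * w"
    unfolding gen_poly_def coeffs v_def w_def by (simp add: algebra_simps power2_eq_square)
  have re: "\<bar>Re z\<bar> < 1" using assms(3) abs_Re_le_cmod[of z] by linarith
  have v: "Re v > 0" using re by (simp add: v_def)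
  have "c * Re z \<ge> c * (-1)" using re c by (intro mult_left_mono) auto
  hence w: "Re w > 0" using c by (simp add: w_def)
  assume "gen_poly \<alpha> z \<in> \<real>\<^sub>\<le>\<^sub>0"
  then obtain r where r: "v * w = of_real r" "r \<le> 0" by (auto simp: eq elim: nonpos_Reals_cases)
  have "w * of_real ((cmod v)\<^sup>2) = of_real r * cnj v"
    using r(1) by (metis complex_norm_square mult.assoc mult.commute)
  from arg_cong[OF this, of Re] have "Re w * (cmod v)\<^sup>2 = r * Re v"
    by (simp add: power2_eq_square)
  moreover have "Re w * (cmod v)\<^sup>2 > 0" using v w by (intro mult_pos_pos) auto
  moreover have "r * Re v \<le> 0" using r v by (simp add: mult_nonpos_nonneg)
  ultimately show False by linarith
qed

lemma W2_holomorphic: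
  assumes "1 < \<alpha>" "\<alpha> < 2"
  shows "W2 \<alpha> holomorphic_on ball 0 1"
proof -
  have "gen_poly \<alpha> holomorphic_on ball 0 1"
    unfolding gen_poly_def by (intro holomorphic_intros)
  thus ?thesis
    unfolding W2_def using gen_poly_not_nonpos[OF assms] by (intro holomorphic_intros) auto
qed

lemma W2_at_0:
  assumes "1 < \<alpha>"
  shows "W2 \<alpha> 0 = of_real (((3 * \<alpha> - 2) / (2 * \<alpha>)) powr \<alpha>)"
  unfolding W2_def gen_poly_def using assms by (simp add: powr_of_real[symmetric] del: of_real_divide)

lemma W2_cnj:
  assumes "1 < \<alpha>" "\<alpha> < 2" "norm z < 1"
  shows "cnj (W2 \<alpha> (cnj z)) = W2 \<alpha> z"
proof -
  have "cnj (gen_poly \<alpha> (cnj z)) = gen_poly \<alpha> z" by (simp add: gen_poly_def)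
  moreover have "gen_poly \<alpha> (cnj z) \<notin> \<real>\<^sub>\<le>\<^sub>0" using gen_poly_not_nonpos assms by simp
  hence "cnj (gen_poly \<alpha> (cnj z) powr of_real \<alpha>) = cnj (gen_poly \<alpha> (cnj z)) powr of_real \<alpha>"
    by (subst cnj_powr) (auto simp: complex_nonpos_Reals_iff)
  ultimately show ?thesis by (simp add: W2_def)
qed

lemma W2_sums:
  assumes "1 < \<alpha>" "\<alpha> < 2" "norm z < 1"
  shows "(\<lambda>l. of_real (kappa2 \<alpha> l) * z ^ l) sums W2 \<alpha> z"
proof -
  define a where "a = fps_nth (fps_expansion (W2 \<alpha>) 0)"
  have a: "(\<lambda>l. a l * w ^ l) sums W2 \<alpha> w" if "norm w < 1" for w
    using holomorphic_power_series[OF W2_holomorphic[OF assms(1,2)], of w] that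
    by (simp add: a_def fps_expansion_def)
  have b: "(\<lambda>l. cnj (a l) * w ^ l) sums W2 \<alpha> w" if "norm w < 1" for w
    using a[of "cnj w"] that W2_cnj[OF assms(1,2) that]
    by (subst sums_cnj[symmetric]) (metis (no_types, lifting) complex_cnj_cnj complex_cnj_mult
        complex_cnj_power complex_mod_cnj sums_cong)
  have "(\<lambda>l. (a l + cnj (a l)) / 2 * z ^ l) sums ((W2 \<alpha> z + W2 \<alpha> z) / 2)"
    using sums_divide[OF sums_add[OF a b], of z z 2] assms(3) by (simp add: algebra_simps)
  moreover have "(a l + cnj (a l)) / 2 = of_real (kappa2 \<alpha> l)" for l
    by (simp add: complex_add_cnj kappa2_def a_def)
  ultimately show ?thesis by simp
qed

end

theory Submission
  imports Defs "HOL-Real_Asymp.Real_Asymp"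
begin

text \<open>The polynomial under the power factors as \<open>(1 - z) * (1 - c + c * z)\<close> with \<open>c = (2 - \<alpha>) / (2 * \<alpha>)\<close>. The first factor generates
  the Grunwald formula, which has first order: with \<open>D\<close> denoting the Liouville derivative of order \<open>\<alpha>\<close>,
  \<open>h powr (- \<alpha>) * (\<Sum>l. g l * u (y - l * h)) = D u y - \<alpha> / 2 * h * D u' y + O(h ^ 2)\<close>. The second factor takes a weighted mean
  of such formulas at the points \<open>y = x + (1 - m) * h\<close>. Its weights have sum 1 and mean \<open>\<alpha> * c = 1 - \<alpha> / 2\<close>, so the
  shifts contribute \<open>\<alpha> / 2 * h * D u' x\<close> on average and the terms of first order cancel
  (\<open>correction_moments\<close>, \<open>correction_raises_order\<close>).

  The expansion of the Grunwald formula, uniform in \<open>y\<close>, is obtained on the real line, without Fourier transforms. Put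
  \<open>\<beta> = 2 - \<alpha>\<close> and let \<open>\<kappa> t = t powr (\<beta> - 1) / Gamma \<beta>\<close> be the kernel of the fractional integral of order \<open>\<beta>\<close>, so that
  \<open>D u\<close> is the convolution of \<open>\<kappa>\<close> with \<open>u''\<close>. Two summations by parts write the Grunwald sum with unit step as the convolution of
  \<open>u''\<close> with a piecewise linear kernel \<open>k\<close>, whose node values are quotients of Gamma functions. Two integrations by
  parts then express the error of the expansion as the integral of the fourth derivative against a function \<open>Q\<close>, the
  second primitive of \<open>\<kappa> - k\<close> minus \<open>\<alpha> / 2\<close> times the first primitive of \<open>\<kappa>\<close>. The second-order asymptotics of Gamma
  quotients (\<open>rising_asymptotics\<close>) shows that \<open>Q\<close> is bounded by a multiple of \<open>\<kappa>\<close> (\<open>kernel_error_bound\<close>), since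
  primitives of \<open>k\<close> have node values of the same type. Rescaling to step \<open>h\<close> gives the error \<open>h ^ 2\<close> times the fractional
  integral of the modulus of the fourth derivative (\<open>grunwald_expansion\<close>).

  Such a fractional integral is bounded uniformly because the integrand is bounded and integrable: a function that is integrable
  together with its derivative is bounded and tends to 0. The same principle and Tonelli's theorem give the
  Taylor expansion of \<open>D u\<close> and the Lipschitz continuity of \<open>D u'\<close> that the shifts require, and the existence of the Liouville
  derivative (\<open>weyl_integral_taylor\<close>, \<open>weyl_integral_has_derivative\<close>).\<close>

section \<open>Quotients of Gamma functions\<close>

text \<open>Up to the factor \<open>Gamma \<gamma>\<close>, this is the quotient \<open>Gamma (n + \<gamma>) / Gamma (n + 1)\<close>; it is the coefficient of \<open>z ^ n\<close> in
  \<open>(1 - z) powr (- \<gamma>)\<close>. With \<open>\<gamma> = - \<alpha>\<close> it gives the Grunwald weights, and passing from \<open>\<gamma>\<close> to \<open>\<gamma> + 1\<close>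
  forms partial sums.\<close>

definition rising :: "real \<Rightarrow> nat \<Rightarrow> real" where
  "rising \<gamma> n = pochhammer \<gamma> n / fact n"

lemma rising_0 [simp]: "rising \<gamma> 0 = 1"
  by (simp add: rising_def)

lemma rising_Suc: "rising \<gamma> (Suc n) = rising \<gamma> n * (\<gamma> + n) / Suc n"
  by (simp add: rising_def pochhammer_Suc)

lemma rising_pos: "\<gamma> > 0 \<Longrightarrow> rising \<gamma> n > 0"
  by (simp add: rising_def pochhammer_pos)

lemma rising_shift: "\<gamma> * rising (\<gamma> + 1) n = (\<gamma> + n) * rising \<gamma> n"
  using pochhammer_rec[of \<gamma> n] pochhammer_Suc[of \<gamma> n] by (simp add: rising_def field_simps)

text \<open>Comparing coefficients in \<open>(1 - z) * (1 - z) powr (- \<gamma>) = (1 - z) powr (- (\<gamma> - 1))\<close>.\<close>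

lemma rising_diff: "rising \<gamma> (Suc n) = rising (\<gamma> - 1) (Suc n) + rising \<gamma> n"
  using rising_shift[of "\<gamma> - 1" n]
  by (simp add: rising_Suc field_simps)

lemma sum_rising: "(\<Sum>l\<le>n. rising (\<gamma> - 1) l) = rising \<gamma> n"
proof (induction n)
  case (Suc n)
  then show ?case using rising_diff[of \<gamma> n] by simp
qed simp

text \<open>The factors \<open>(\<gamma> + k) / (k + 1)\<close> of the coefficient have modulus at most 1.\<close>

lemma abs_rising_le_1:
  assumes "\<bar>\<gamma>\<bar> \<le> 1"
  shows "\<bar>rising \<gamma> n\<bar> \<le> 1"
proof (induction n)
  case (Suc n)
  have "\<bar>rising \<gamma> (Suc n)\<bar> = \<bar>rising \<gamma> n\<bar> * (\<bar>\<gamma> + n\<bar> / Suc n)"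
    by (simp add: rising_Suc abs_mult)
  also have "\<dots> \<le> 1 * 1" using Suc assms by (intro mult_mono) (auto simp: field_simps)
  finally show ?case by simp
qed simp

text \<open>From the index 2 on, the coefficients of \<open>(1 - z) powr \<alpha>\<close> are nonnegative, and their partial sums are coefficients
  of \<open>(1 - z) powr (\<alpha> - 1)\<close>, which are bounded.\<close>

lemma abs_summable_rising:
  assumes \<alpha>: "1 < \<alpha>" "\<alpha> < 2"
  shows "summable (\<lambda>l. \<bar>rising (- \<alpha>) l\<bar>)"
proof -
  have bnd: "\<bar>rising (1 - \<alpha>) n\<bar> \<le> 1" for n
    using \<alpha> by (intro abs_rising_le_1) auto
  have pos: "rising (- \<alpha>) (l + 2) \<ge> 0" for l
  proof (induction l)
    case 0
    have "rising (- \<alpha>) 2 = (- \<alpha>) * (1 - \<alpha>) / 2" by (simp add: numeral_2_eq_2 rising_Suc)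
    moreover have "\<alpha> * (1 - \<alpha>) \<le> 0" using \<alpha> by (intro mult_nonneg_nonpos) auto
    ultimately show ?case by (simp add: numeral_2_eq_2)
  next
    case (Suc l)
    have "rising (- \<alpha>) (Suc l + 2) = rising (- \<alpha>) (l + 2) * ((real l + 2 - \<alpha>) / (real l + 3))"
      using rising_Suc[of "- \<alpha>" "l + 2"] by (simp add: algebra_simps)
    moreover have "(real l + 2 - \<alpha>) / (real l + 3) \<ge> 0" using \<alpha> by simp
    ultimately show ?case using Suc by (simp only: mult_nonneg_nonneg)
  qed
  have "summable (\<lambda>l. rising (- \<alpha>) (l + 2))"
  proof (rule bounded_imp_summable[where B = \<alpha>])
    fix n
    have "(\<Sum>k\<le>n. rising (- \<alpha>) (k + 2)) = (\<Sum>k\<le>n + 2. rising (- \<alpha>) k) - (1 - \<alpha>)"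
      using sum.atMost_Suc_shift[of "rising (- \<alpha>)" "Suc n"]
        sum.atMost_Suc_shift[of "\<lambda>k. rising (- \<alpha>) (Suc k)" n]
      by (simp add: rising_Suc[of _ 0] del: sum.atMost_Suc)
    also have "(\<Sum>k\<le>n + 2. rising (- \<alpha>) k) = rising (1 - \<alpha>) (n + 2)"
      using sum_rising[of "1 - \<alpha>" "n + 2"] by simp
    also have "\<dots> \<le> 1" using bnd[of "n + 2"] by linarith
    finally show "(\<Sum>k\<le>n. rising (- \<alpha>) (k + 2)) \<le> \<alpha>" by linarith
  qed (rule pos)
  then have "summable (\<lambda>l. \<bar>rising (- \<alpha>) (l + 2)\<bar>)" using pos by simp
  then show ?thesis by (subst (asm) summable_iff_shift)
qed

lemma telescoping_cubic_decay_lower: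
  fixes L :: "nat \<Rightarrow> real"
  assumes lim: "L \<longlonglongrightarrow> 0" and C: "C \<ge> 0" and N: "N \<ge> 1"
    and step: "\<And>n. n \<ge> N \<Longrightarrow> \<bar>L (Suc n) - L n\<bar> \<le> C / real n ^ 3" and n: "n \<ge> N"
  shows "L n \<ge> - (2 * C / real n ^ 2)"
proof -
  (* U telescopes downwards to 0, because n^-3 is at most twice the decrement of n^-2. *)
  define U where "U = (\<lambda>k. L (k + N) + 2 * C / real (k + N) ^ 2)"
  have key: "1 / real n ^ 3 \<le> 2 * (1 / real n ^ 2 - 1 / real (Suc n) ^ 2)" if "n \<ge> 1" for n
  proof -
    have "2 * (1 / real n ^ 2 - 1 / real (Suc n) ^ 2) - 1 / real n ^ 3
          = (3 * real n ^ 2 - 1) / (real n ^ 3 * real (Suc n) ^ 2)"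
      using that by (simp add: divide_simps) (simp add: algebra_simps power2_eq_square power3_eq_cube)
    moreover have "3 * real n ^ 2 - 1 \<ge> 0" proof -
      have "1 \<le> real n ^ 2" using that by (intro one_le_power) auto
      then show ?thesis by linarith
    qed
    then have "(3 * real n ^ 2 - 1) / (real n ^ 3 * real (Suc n) ^ 2) \<ge> 0"
      by (intro divide_nonneg_nonneg) auto
    ultimately show ?thesis by linarith
  qed
  have "decseq U"
  proof (rule decseq_SucI)
    fix k
    have "\<bar>L (Suc (k+N)) - L (k+N)\<bar> \<le> C * (1 / real (k+N) ^ 3)" using step[of "k+N"] by simp
    also have "\<dots> \<le> C * (2 * (1 / real (k+N) ^ 2 - 1 / real (Suc (k+N)) ^ 2))"
      using key[of "k+N"] N C by (intro mult_left_mono) auto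
    finally show "U (Suc k) \<le> U k" by (simp add: U_def algebra_simps)
  qed
  moreover have "U \<longlonglongrightarrow> 0"
  proof -
    have "(\<lambda>k. L k + 2 * C / real k ^ 2) \<longlonglongrightarrow> 0 + 0"
      by (intro tendsto_add lim) real_asymp
    from LIMSEQ_ignore_initial_segment[OF this, of N] show ?thesis by (simp add: U_def)
  qed
  ultimately have "U (n - N) \<ge> 0" by (rule decseq_ge)
  then show ?thesis using n by (simp add: U_def)
qed

text \<open>A null sequence is minus the sum of its later increments, and a tail of \<open>1 / n ^ 3\<close> is of size \<open>1 / n ^ 2\<close>.\<close>

lemma telescoping_cubic_decay:
  fixes L :: "nat \<Rightarrow> real"
  assumes lim: "L \<longlonglongrightarrow> 0" and step: "(\<lambda>n. L (Suc n) - L n) \<in> O(\<lambda>n. 1 / real n ^ 3)"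
  shows "L \<in> O(\<lambda>n. 1 / real n ^ 2)"
proof -
  obtain C where C: "C > 0" and "\<forall>\<^sub>F n in sequentially. norm (L (Suc n) - L n) \<le> C * norm (1 / real n ^ 3)"
    using landau_o.bigE[OF step] by blast
  then obtain N0 where N0: "\<And>n. n \<ge> N0 \<Longrightarrow> \<bar>L (Suc n) - L n\<bar> \<le> C / real n ^ 3"
    by (auto simp: eventually_sequentially)
  define N where "N = max N0 1"
  have "\<bar>L n\<bar> \<le> 2 * C * (1 / real n ^ 2)" if "n \<ge> N" for n
    using telescoping_cubic_decay_lower[of L C N n] telescoping_cubic_decay_lower[of "\<lambda>n. - L n" C N n]
      lim tendsto_minus[OF lim] C N0 that by (fastforce simp: N_def abs_le_iff abs_minus_commute)
  then show ?thesis
    by (intro bigoI[of _ "2 * C"]) (auto simp: eventually_sequentially)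
qed

lemma abs_exp_minus_linear_le:
  fixes x :: real
  assumes "\<bar>x\<bar> \<le> 1"
  shows "\<bar>exp x - 1 - x\<bar> \<le> x\<^sup>2"
proof -
  have "exp x \<le> 1 + x + x\<^sup>2"
  proof (cases "x \<ge> 0")
    case True
    then show ?thesis using exp_bound[of x] assms by simp
  next
    case False
    have "1 - x \<le> exp (- x)" using exp_ge_add_one_self[of "- x"] by simp
    then have "exp x * (1 - x) \<le> 1" by (simp add: exp_minus field_simps)
    also have "1 \<le> (1 + x + x\<^sup>2) * (1 - x)"
    proof -
      have "x ^ 3 \<le> 0" using False by (simp add: power_le_zero_eq)
      moreover have "(1 + x + x\<^sup>2) * (1 - x) = 1 - x ^ 3"
        by (simp add: algebra_simps power2_eq_square power3_eq_cube)
      ultimately show ?thesis by linarith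
    qed
    finally show ?thesis using False by simp
  qed
  then show ?thesis using exp_ge_add_one_self[of x] by linarith
qed

text \<open>The second-order expansion of the Gamma quotient. The logarithm of the quotient of both sides has increments of order
  \<open>1 / n ^ 3\<close>, by the Taylor expansion of the logarithm, and it tends to 0 by the limit formula for the Gamma
  function; \<open>telescoping_cubic_decay\<close> then gives the rate.\<close>

lemma rising_asymptotics:
  assumes \<beta>: "\<beta> > 0"
  shows "(\<lambda>n. rising \<beta> n * Gamma \<beta> / real n powr (\<beta> - 1) - 1 - \<beta> * (\<beta> - 1) / 2 / real n)
           \<in> O(\<lambda>n. 1 / real n ^ 2)"
proof -
  define d where "d = \<beta> * (\<beta> - 1) / 2"
  define a where "a = (\<lambda>n. rising \<beta> n * Gamma \<beta> / real n powr (\<beta> - 1))"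
  (* d is the value for which the increments of L lose their terms of orders 1/n and 1/n^2. *)
  define L where "L = (\<lambda>n. ln (a n) - d / real n)"
  have G: "Gamma \<beta> > 0" using \<beta> by (rule Gamma_real_pos)
  have a_pos: "a n > 0" if "n > 0" for n
    using that \<beta> rising_pos[of \<beta> n] G by (simp add: a_def)
  have a_lim: "a \<longlonglongrightarrow> 1"
  proof -
    have "(\<lambda>n. Gamma \<beta> / Gamma_series' \<beta> n) \<longlonglongrightarrow> Gamma \<beta> / Gamma \<beta>"
      using G by (intro tendsto_intros Gamma_series'_LIMSEQ) auto
    moreover have "\<forall>\<^sub>F n in sequentially. Gamma \<beta> / Gamma_series' \<beta> n = a n"
      using eventually_gt_at_top[of 0]
    proof eventually_elim
      case (elim n)
      have "real n powr (\<beta> - 1) = real n powr \<beta> / n" using elim by (simp add: powr_diff)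
      moreover have "fact n = real n * fact (n - 1)" using elim by (simp add: fact_reduce)
      moreover have "exp (\<beta> * ln (real n)) = real n powr \<beta>" using elim by (simp add: powr_def)
      ultimately show ?case using elim by (simp add: a_def rising_def Gamma_series'_def)
    qed
    ultimately show ?thesis using G by (simp add: tendsto_cong)
  qed
  have L_lim: "L \<longlonglongrightarrow> 0"
  proof -
    have "(\<lambda>n. ln (a n) - d / real n) \<longlonglongrightarrow> ln 1 - 0"
      by (intro tendsto_diff tendsto_ln a_lim) (simp, real_asymp)
    then show ?thesis by (simp add: L_def)
  qed
  have "(\<lambda>n. L (Suc n) - L n) \<in> O(\<lambda>n. 1 / real n ^ 3)"
  proof -
    have 1: "(\<lambda>n. ln (1 + \<beta> / real n) - \<beta> / real n + \<beta>\<^sup>2 / 2 / real n ^ 2) \<in> O(\<lambda>n. 1 / real n ^ 3)"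
    proof -
      have "(\<lambda>x::real. ln (1 + x) - x + x\<^sup>2 / 2) \<in> O[at_right 0](\<lambda>x. x ^ 3)"
        by real_asymp
      moreover have "filterlim (\<lambda>n. \<beta> / real n) (at_right 0) sequentially"
        using \<beta> by real_asymp
      ultimately have "(\<lambda>n. ln (1 + \<beta> / real n) - \<beta> / real n + (\<beta> / real n)\<^sup>2 / 2)
          \<in> O(\<lambda>n. (\<beta> / real n) ^ 3)"
        by (rule landau_o.big.compose)
      also have "(\<lambda>n. (\<beta> / real n) ^ 3) \<in> O(\<lambda>n. 1 / real n ^ 3)"
        using \<beta> by (intro bigoI[of _ "\<beta> ^ 3"]) (auto simp: power_divide)
      finally show ?thesis by (simp add: power_divide mult.commute)
    qed
    have 2: "(\<lambda>n. (- \<beta>) * (ln (1 + 1 / real n) - 1 / real n + 1 / 2 / real n ^ 2)) \<in> O(\<lambda>n. 1 / real n ^ 3)"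
      using \<beta> by (subst landau_o.big.cmult_in_iff) (simp, real_asymp)
    have 3: "(\<lambda>n. (- d) * (1 / real (Suc n) - 1 / real n + 1 / real n ^ 2)) \<in> O(\<lambda>n. 1 / real n ^ 3)"
    proof (cases "d = 0")
      case False
      then show ?thesis by (subst landau_o.big.cmult_in_iff) (simp, real_asymp)
    qed simp
    have eq: "L (Suc n) - L n = (ln (1 + \<beta> / real n) - \<beta> / real n + \<beta>\<^sup>2 / 2 / real n ^ 2)
          + (- \<beta>) * (ln (1 + 1 / real n) - 1 / real n + 1 / 2 / real n ^ 2)
          + (- d) * (1 / real (Suc n) - 1 / real n + 1 / real n ^ 2)" if n: "n > 0" for n
    proof -
      have ln_a: "ln (a k) = ln (rising \<beta> k) + ln (Gamma \<beta>) - (\<beta> - 1) * ln (real k)" if "k > 0" for k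
        using that rising_pos[OF \<beta>, of k] G by (simp add: a_def ln_div ln_mult ln_powr)
      have "ln (rising \<beta> (Suc n)) = ln (rising \<beta> n) + ln (\<beta> + n) - ln (Suc n)"
        using rising_pos[OF \<beta>, of n] \<beta> by (simp add: rising_Suc ln_div ln_mult)
      moreover have "ln (1 + \<beta> / real n) = ln (\<beta> + n) - ln n"
        using n \<beta> ln_div[of "\<beta> + n" n] by (simp add: add_divide_distrib add.commute)
      moreover have "ln (1 + 1 / real n) = ln (Suc n) - ln n"
        using n ln_div[of "1 + real n" n] by (simp add: add_divide_distrib add.commute)
      moreover have "\<beta>\<^sup>2 / 2 / real n ^ 2 - \<beta> * (1 / 2 / real n ^ 2) - d / real n ^ 2 = 0"
        by (simp add: d_def power2_eq_square algebra_simps diff_divide_distrib add_divide_distrib)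
      ultimately show ?thesis using n by (simp add: L_def ln_a) (simp add: algebra_simps)
    qed
    have "(\<lambda>n. (ln (1 + \<beta> / real n) - \<beta> / real n + \<beta>\<^sup>2 / 2 / real n ^ 2)
          + (- \<beta>) * (ln (1 + 1 / real n) - 1 / real n + 1 / 2 / real n ^ 2)
          + (- d) * (1 / real (Suc n) - 1 / real n + 1 / real n ^ 2)) \<in> O(\<lambda>n. 1 / real n ^ 3)"
      by (intro sum_in_bigo 1 2 3)
    then show ?thesis
      by (rule landau_o.big.in_cong[THEN iffD2, rotated])
        (use eventually_gt_at_top[of 0] in \<open>eventually_elim, use eq in blast\<close>)
  qed
  with L_lim have L: "L \<in> O(\<lambda>n. 1 / real n ^ 2)" by (rule telescoping_cubic_decay)
  (* Back from logarithms: a n = exp (y n), and y n is small enough to linearise the exponential. *)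
  define y where "y = (\<lambda>n. d / real n + L n)"
  have y: "y \<in> O(\<lambda>n. 1 / real n)"
    unfolding y_def by (intro sum_in_bigo landau_o.big.trans[OF L]) real_asymp+
  have y_lim: "y \<longlonglongrightarrow> 0"
  proof -
    have "(\<lambda>n. d / real n) \<longlonglongrightarrow> 0" by real_asymp
    from tendsto_add[OF this L_lim] show ?thesis by (simp add: y_def)
  qed
  have "(\<lambda>n. exp (y n) - 1 - y n) \<in> O(\<lambda>n. y n ^ 2)"
  proof (rule bigoI[of _ 1])
    have "\<forall>\<^sub>F n in sequentially. \<bar>y n\<bar> < 1" using y_lim by (auto simp: tendsto_iff dist_real_def)
    then show "\<forall>\<^sub>F n in sequentially. norm (exp (y n) - 1 - y n) \<le> 1 * norm (y n ^ 2)"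
      by eventually_elim (use abs_exp_minus_linear_le in auto)
  qed
  also have "(\<lambda>n. y n ^ 2) \<in> O(\<lambda>n. (1 / real n) ^ 2)"
    by (rule landau_o.big_power[OF y])
  finally have "(\<lambda>n. exp (y n) - 1 - y n) \<in> O(\<lambda>n. 1 / real n ^ 2)"
    by (simp add: power_divide)
  from sum_in_bigo(1)[OF this L]
  have "(\<lambda>n. (exp (y n) - 1 - y n) + L n) \<in> O(\<lambda>n. 1 / real n ^ 2)" .
  moreover have "\<forall>\<^sub>F n in sequentially. (exp (y n) - 1 - y n) + L n = a n - 1 - d / real n"
    using eventually_gt_at_top[of 0] by eventually_elim (use a_pos in \<open>auto simp: y_def L_def\<close>)
  ultimately show ?thesis
    by (simp add: a_def d_def landau_o.big.in_cong)
qed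

text \<open>The same expansion as an explicit inequality that holds from the first index on.\<close>

lemma rising_asymptotics_bound:
  assumes \<beta>: "\<beta> > 0"
  obtains K where "K \<ge> 0" and "\<And>n. n \<ge> 1 \<Longrightarrow>
    \<bar>rising \<beta> n * Gamma \<beta> / real n powr (\<beta> - 1) - 1 - \<beta> * (\<beta> - 1) / 2 / real n\<bar> \<le> K / real n ^ 2"
proof -
  define f where "f = (\<lambda>n. rising \<beta> n * Gamma \<beta> / real n powr (\<beta> - 1) - 1 - \<beta> * (\<beta> - 1) / 2 / real n)"
  obtain c where c: "c > 0" "\<forall>\<^sub>F n in sequentially. norm (f n) \<le> c * norm (1 / real n ^ 2)"
    using landau_o.bigE[OF rising_asymptotics[OF \<beta>]] unfolding f_def by blast
  have "\<forall>\<^sub>F n in sequentially. norm (f n * real n ^ 2) \<le> norm c"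
    using c(2) eventually_gt_at_top[of 0] by eventually_elim (use c(1) in \<open>auto simp: field_simps abs_mult\<close>)
  then have "Bseq (\<lambda>n. f n * real n ^ 2)"
    by (rule Bseq_eventually_mono) simp
  then obtain K where K: "K > 0" "\<And>n. norm (f n * real n ^ 2) \<le> K" by (auto elim: BseqE)
  show thesis
  proof (rule that[of K])
    fix n :: nat assume "n \<ge> 1"
    then have "\<bar>f n\<bar> \<le> K / real n ^ 2"
      using K(2)[of n] by (simp add: abs_mult pos_le_divide_eq)
    then show "\<bar>rising \<beta> n * Gamma \<beta> / real n powr (\<beta> - 1) - 1 - \<beta> * (\<beta> - 1) / 2 / real n\<bar> \<le> K / real n ^ 2"
      by (simp only: f_def)
  qed (use K in simp)
qed

section \<open>The generating function as a product\<close>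

text \<open>The coefficients of \<open>(1 - c + c * z) powr \<alpha>\<close> with \<open>c = (2 - \<alpha>) / (2 * \<alpha>)\<close>, the factor by which the generating
  function differs from the first-order one, \<open>(1 - z) powr \<alpha>\<close>.\<close>

definition correction :: "real \<Rightarrow> nat \<Rightarrow> real" where
  "correction \<alpha> m = (let c = (2 - \<alpha>) / (2 * \<alpha>) in (1 - c) powr \<alpha> * ((\<alpha> gchoose m) * (c / (1 - c)) ^ m))"

text \<open>The root at 1 splits off, so that the generating function of the Grunwald formula becomes a factor of the given one.\<close>

lemma gen_poly_factor:
  assumes "\<alpha> > 0" and c: "c = (2 - \<alpha>) / (2 * \<alpha>)"
  shows "gen_poly \<alpha> z = (1 - z) * (of_real (1 - c) + of_real c * z)"
proof -
  have coeffs: "(3 * \<alpha> - 2) / (2 * \<alpha>) = 1 - c" "2 * (\<alpha> - 1) / \<alpha> = 1 - 2 * c" "(\<alpha> - 2) / (2 * \<alpha>) = - c"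
    using assms by (auto simp: c field_simps)
  show ?thesis
    unfolding gen_poly_def coeffs by (simp add: algebra_simps power2_eq_square)
qed

text \<open>The arguments add up to less than \<open>pi\<close>, so the principal logarithms add.\<close>

lemma powr_mult_right_half_plane:
  fixes v w a :: complex
  assumes "Re v > 0" "Re w > 0"
  shows "(v * w) powr a = v powr a * w powr a"
proof -
  have "v \<noteq> 0" "w \<noteq> 0" using assms by auto
  moreover have "\<bar>Im (Ln v)\<bar> < pi / 2" "\<bar>Im (Ln w)\<bar> < pi / 2"
    using assms Re_Ln_pos_lt_imp by (auto simp: Re_Ln_pos_lt)
  then have "\<not> Im (Ln v + Ln w) \<le> - pi" "\<not> Im (Ln v + Ln w) > pi"
    unfolding plus_complex.simps by linarith+
  ultimately have "Ln (v * w) = Ln v + Ln w" by (simp add: Ln_times)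
  then show ?thesis
    using \<open>v \<noteq> 0\<close> \<open>w \<noteq> 0\<close> by (simp add: powr_def exp_add distrib_left)
qed

text \<open>The factor \<open>1 - c\<close> is pulled out of the second base so that both remaining powers are binomial series.\<close>

lemma W2_factor:
  assumes "1 < \<alpha>" "\<alpha> < 2" "norm z < 1"
  defines "c \<equiv> (2 - \<alpha>) / (2 * \<alpha>)"
  shows "W2 \<alpha> z = (1 - z) powr of_real \<alpha> * (of_real ((1 - c) powr \<alpha>) * (1 + of_real (c / (1 - c)) * z) powr of_real \<alpha>)"
proof -
  have c: "0 < c" "c < 1 / 2" using assms by (auto simp: c_def field_simps)
  have q: "0 < c / (1 - c)" "c / (1 - c) < 1" using c by (auto simp: field_simps)
  have re: "\<bar>Re z\<bar> < 1" using assms(3) abs_Re_le_cmod[of z] by linarith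
  (* Both factors stay in the right half-plane, since |z| < 1 and c / (1 - c) < 1. *)
  have "\<bar>c / (1 - c) * Re z\<bar> < 1"
    using q re c mult_strict_mono'[of "c / (1 - c)" 1 "\<bar>Re z\<bar>" 1] by (simp add: abs_mult)
  then have "c / (1 - c) * Re z > - 1" by linarith
  then have pos: "Re (1 - z) > 0" "Re (1 + of_real (c / (1 - c)) * z) > 0" using re by auto
  have eq: "of_real (1 - c) + of_real c * z = of_real (1 - c) * (1 + of_real (c / (1 - c)) * z)"
    using c by (simp add: field_simps)
  have "Re (of_real (1 - c) * (1 + of_real (c / (1 - c)) * z)) > 0"
    using pos(2) c by (simp only: Re_complex_of_real Im_complex_of_real times_complex.simps) simp
  moreover have "gen_poly \<alpha> z = (1 - z) * (of_real (1 - c) * (1 + of_real (c / (1 - c)) * z))"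
    unfolding eq[symmetric] by (rule gen_poly_factor) (use assms(1) in \<open>simp_all add: c_def\<close>)
  ultimately have "W2 \<alpha> z = (1 - z) powr of_real \<alpha> * (of_real (1 - c) * (1 + of_real (c / (1 - c)) * z)) powr of_real \<alpha>"
    unfolding W2_def using powr_mult_right_half_plane[OF pos(1)] by simp
  also have "(of_real (1 - c) * (1 + of_real (c / (1 - c)) * z)) powr of_real \<alpha>
      = of_real (1 - c) powr of_real \<alpha> * (1 + of_real (c / (1 - c)) * z) powr (of_real \<alpha> :: complex)"
    using pos c by (intro powr_mult_right_half_plane) auto
  also have "of_real (1 - c) powr (of_real \<alpha> :: complex) = of_real ((1 - c) powr \<alpha>)"
    using c by (subst powr_of_real) auto
  finally show ?thesis .
qed

text \<open>The generating function is a product, so its coefficients form a Cauchy product.\<close>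

lemma kappa2_eq:
  assumes \<alpha>: "1 < \<alpha>" "\<alpha> < 2"
  shows "kappa2 \<alpha> l = (\<Sum>m\<le>l. correction \<alpha> m * rising (- \<alpha>) (l - m))"
proof -
  define c where "c = (2 - \<alpha>) / (2 * \<alpha>)"
  define q where "q = c / (1 - c)"
  define A where "A = fps_compose (fps_binomial (complex_of_real \<alpha>)) (fps_const (-1) * fps_X)"
  define B where "B = fps_const (complex_of_real ((1 - c) powr \<alpha>)) * fps_compose (fps_binomial (complex_of_real \<alpha>)) (fps_const (of_real q) * fps_X)"
  have lin: "(\<lambda>z. k * z) has_fps_expansion fps_const k * fps_X" for k :: complex
    by (intro fps_expansion_intros)
  have A: "(\<lambda>z. (1 - z) powr of_real \<alpha>) has_fps_expansion A"
    using has_fps_expansion_compose[OF has_fps_expansion_binomial_complex[of "of_real \<alpha>"] lin[of "-1"]]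
    by (simp add: A_def o_def)
  have B: "(\<lambda>z. of_real ((1 - c) powr \<alpha>) * (1 + of_real q * z) powr of_real \<alpha>) has_fps_expansion B"
    unfolding B_def
    using has_fps_expansion_compose[OF has_fps_expansion_binomial_complex[of "of_real \<alpha>"] lin[of "of_real q"]]
    by (intro fps_expansion_intros) (simp add: o_def)
  have "(\<lambda>z. of_real ((1 - c) powr \<alpha>) * (1 + of_real q * z) powr of_real \<alpha> * (1 - z) powr of_real \<alpha>) has_fps_expansion B * A"
    by (intro fps_expansion_intros A B)
  moreover have "\<forall>\<^sub>F z in nhds 0. of_real ((1 - c) powr \<alpha>) * (1 + of_real q * z) powr of_real \<alpha> * (1 - z) powr of_real \<alpha> = W2 \<alpha> z"
  proof -
    have "\<forall>\<^sub>F z in nhds 0. z \<in> ball (0 :: complex) 1" by (intro eventually_nhds_in_open) auto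
    then show ?thesis
      by eventually_elim (use W2_factor[OF \<alpha>] in \<open>simp add: c_def q_def mult_ac\<close>)
  qed
  ultimately have "W2 \<alpha> has_fps_expansion B * A"
    by (subst (asm) has_fps_expansion_cong[OF _ refl])
  then have "fps_expansion (W2 \<alpha>) 0 = B * A" by (rule fps_expansion_eqI)
  then have "kappa2 \<alpha> l = Re (\<Sum>m\<le>l. fps_nth B m * fps_nth A (l - m))"
    by (simp add: kappa2_def fps_mult_nth atLeast0AtMost)
  also have "(\<Sum>m\<le>l. fps_nth B m * fps_nth A (l - m)) = (\<Sum>m\<le>l. of_real (correction \<alpha> m * rising (- \<alpha>) (l - m)))"
  proof (rule sum.cong)
    fix m
    have gb: "complex_of_real \<alpha> gchoose k = of_real (\<alpha> gchoose k)" for k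
      by (simp add: gbinomial_prod_rev)
    have "fps_nth B m = of_real (correction \<alpha> m)"
      by (simp add: B_def correction_def fps_nth_compose_linear gb Let_def q_def c_def)
    moreover have "fps_nth A (l - m) = of_real (rising (- \<alpha>) (l - m))"
      by (simp only: A_def fps_nth_compose_linear fps_binomial_nth gb)
         (simp add: rising_def gbinomial_pochhammer flip: power_mult_distrib)
    ultimately show "fps_nth B m * fps_nth A (l - m) = of_real (correction \<alpha> m * rising (- \<alpha>) (l - m))"
      by simp
  qed simp
  finally show ?thesis by (simp flip: of_real_sum)
qed

lemma abs_summable_binomial:
  fixes x :: real
  assumes "\<bar>x\<bar> < 1"
  shows "summable (\<lambda>n. \<bar>(a gchoose n) * x ^ n\<bar>)"
proof -
  obtain r where r: "\<bar>x\<bar> < r" "r < 1" using dense[OF assms] by blast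
  have "summable (\<lambda>n. (a gchoose n) * r ^ n)"
    using gen_binomial_real[of r a] r by (auto simp: sums_iff)
  from powser_insidea[OF this, of x] show ?thesis using r by simp
qed

text \<open>The first two sums are the value and the derivative at 1 of \<open>(1 - c + c * z) powr \<alpha>\<close>. The mean \<open>\<alpha> * c = 1 - \<alpha> / 2\<close>
  is the number for which the shift by one node and the first-order Grunwald error, with coefficient \<open>\<alpha> / 2\<close>, cancel;
  it determines \<open>c\<close>. The weights decay geometrically, whence the second moment.\<close>

lemma correction_moments:
  assumes \<alpha>: "1 < \<alpha>" "\<alpha> < 2"
  shows "correction \<alpha> sums 1"
    and "(\<lambda>m. real m * correction \<alpha> m) sums (1 - \<alpha> / 2)"
    and "summable (\<lambda>m. (1 + (real m)\<^sup>2) * \<bar>correction \<alpha> m\<bar>)"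
proof -
  define c where "c = (2 - \<alpha>) / (2 * \<alpha>)"
  define q where "q = c / (1 - c)"
  define p where "p = (1 - c) powr \<alpha>"
  have c: "0 < c" "c < 1 / 2" using assms by (auto simp: c_def field_simps)
  have q: "0 < q" "q < 1" using c by (auto simp: q_def field_simps)
  have corr: "correction \<alpha> = (\<lambda>m. p * ((\<alpha> gchoose m) * q ^ m))"
    by (simp add: fun_eq_iff correction_def Let_def c_def q_def p_def)
  have p: "p > 0" using c by (simp add: p_def)
  have q1: "1 + q = 1 / (1 - c)" using c by (simp add: q_def field_simps)
  have "correction \<alpha> sums (p * (1 + q) powr \<alpha>)"
    unfolding corr using q by (intro sums_mult gen_binomial_real) auto
  moreover have "p * (1 + q) powr \<alpha> = 1"
    unfolding q1 p_def using c by (simp add: powr_divide)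
  ultimately show "correction \<alpha> sums 1" by simp
  have first: "real (Suc m) * ((a gchoose Suc m) * q ^ Suc m) = a * q * ((a - 1 gchoose m) * q ^ m)" for a m
  proof -
    have "real (Suc m) * ((a gchoose Suc m) * q ^ Suc m) = (real (Suc m) * (a gchoose Suc m)) * (q * q ^ m)" by simp
    then show ?thesis by (simp only: gbinomial_absorption mult_ac)
  qed
  have "(\<lambda>m. real (Suc m) * correction \<alpha> (Suc m)) sums (p * (\<alpha> * q * (1 + q) powr (\<alpha> - 1)))"
  proof -
    have "(\<lambda>m. p * (\<alpha> * q * ((\<alpha> - 1 gchoose m) * q ^ m))) sums (p * (\<alpha> * q * (1 + q) powr (\<alpha> - 1)))"
      using q by (intro sums_mult gen_binomial_real) auto
    then show ?thesis unfolding corr first[symmetric] by (simp only: mult.left_commute[of p])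
  qed
  then have "(\<lambda>m. real m * correction \<alpha> m) sums (p * (\<alpha> * q * (1 + q) powr (\<alpha> - 1)))"
    by (subst (asm) sums_Suc_iff) simp
  moreover have "p * (\<alpha> * q * (1 + q) powr (\<alpha> - 1)) = 1 - \<alpha> / 2"
  proof -
    have "p * (\<alpha> * q * (1 + q) powr (\<alpha> - 1)) = \<alpha> * q * (1 - c)"
      unfolding q1 p_def using c by (simp add: powr_divide powr_diff)
    also have "\<dots> = \<alpha> * c" using c by (simp add: q_def)
    also have "\<dots> = 1 - \<alpha> / 2" using \<alpha> by (simp add: c_def field_simps)
    finally show ?thesis .
  qed
  ultimately show "(\<lambda>m. real m * correction \<alpha> m) sums (1 - \<alpha> / 2)" by simp
  (* The weights m and m^2 are absorbed into the binomial coefficients by lowering the upper index. *)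
  have s0: "summable (\<lambda>m. \<bar>(a gchoose m) * q ^ m\<bar>)" for a
    using q by (intro abs_summable_binomial) auto
  have s1: "summable (\<lambda>m. real m * \<bar>(a gchoose m) * q ^ m\<bar>)" for a
  proof -
    have "summable (\<lambda>m. \<bar>a * q\<bar> * \<bar>(a - 1 gchoose m) * q ^ m\<bar>)"
      by (intro summable_mult s0)
    then have "summable (\<lambda>m. real (Suc m) * \<bar>(a gchoose Suc m) * q ^ Suc m\<bar>)"
      unfolding abs_mult[symmetric] first[symmetric] by (simp only: abs_mult abs_of_nat)
    then show ?thesis by (subst (asm) summable_Suc_iff)
  qed
  have s2: "summable (\<lambda>m. (real m)\<^sup>2 * \<bar>(\<alpha> gchoose m) * q ^ m\<bar>)"
  proof -
    have "summable (\<lambda>m. \<bar>\<alpha> * q\<bar> * (real m * \<bar>(\<alpha> - 1 gchoose m) * q ^ m\<bar> + \<bar>(\<alpha> - 1 gchoose m) * q ^ m\<bar>))"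
      by (intro summable_mult summable_add s0 s1)
    moreover have "\<bar>\<alpha> * q\<bar> * (real m * \<bar>(\<alpha> - 1 gchoose m) * q ^ m\<bar> + \<bar>(\<alpha> - 1 gchoose m) * q ^ m\<bar>)
        = (real (Suc m))\<^sup>2 * \<bar>(\<alpha> gchoose Suc m) * q ^ Suc m\<bar>" for m
    proof -
      have "(real (Suc m))\<^sup>2 * \<bar>(\<alpha> gchoose Suc m) * q ^ Suc m\<bar>
          = real (Suc m) * \<bar>real (Suc m) * ((\<alpha> gchoose Suc m) * q ^ Suc m)\<bar>"
        by (simp only: power2_eq_square abs_mult abs_of_nat mult.assoc)
      also have "\<dots> = real (Suc m) * (\<bar>\<alpha> * q\<bar> * \<bar>(\<alpha> - 1 gchoose m) * q ^ m\<bar>)"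
        by (simp only: first abs_mult)
      finally show ?thesis by (simp add: algebra_simps)
    qed
    ultimately have "summable (\<lambda>m. (real (Suc m))\<^sup>2 * \<bar>(\<alpha> gchoose Suc m) * q ^ Suc m\<bar>)" by simp
    then show ?thesis by (subst (asm) summable_Suc_iff)
  qed
  have "summable (\<lambda>m. p * (\<bar>(\<alpha> gchoose m) * q ^ m\<bar> + (real m)\<^sup>2 * \<bar>(\<alpha> gchoose m) * q ^ m\<bar>))"
    by (intro summable_mult summable_add s0 s2)
  then show "summable (\<lambda>m. (1 + (real m)\<^sup>2) * \<bar>correction \<alpha> m\<bar>)"
    unfolding corr using p by (simp add: abs_mult algebra_simps)
qed

lemma abs_summable_correction:
  assumes \<alpha>: "1 < \<alpha>" "\<alpha> < 2"
  shows "summable (\<lambda>m. \<bar>correction \<alpha> m\<bar>)"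
  by (rule summable_comparison_test'[OF correction_moments(3)[OF \<alpha>], of 0])
    (auto simp: algebra_simps)

section \<open>The discrete kernel and its distance to the power kernel\<close>

text \<open>The partial sums of the Grunwald weights define a step function, with the value \<open>spline_D \<beta> n\<close> on the cell from
  \<open>n\<close> to \<open>n + 1\<close>, where \<open>\<beta> = 2 - \<alpha>\<close>. The sequences \<open>spline_A\<close>, \<open>spline_B\<close>, \<open>spline_C\<close> are the values at the nodes of its
  first, second and third primitives that vanish at 0, in closed form.\<close>

definition "spline_D \<beta> n = rising (\<beta> - 1) n"

definition "spline_A \<beta> n = rising \<beta> n - rising (\<beta> - 1) n"

definition "spline_B \<beta> n = rising (\<beta> + 1) n - 3 / 2 * rising \<beta> n + rising (\<beta> - 1) n / 2"

definition "spline_C \<beta> n = rising (\<beta> + 2) n - 2 * rising (\<beta> + 1) n + 7 / 6 * rising \<beta> n - rising (\<beta> - 1) n / 6"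

lemma spline_0 [simp]:
  "spline_D \<beta> 0 = 1" "spline_A \<beta> 0 = 0" "spline_B \<beta> 0 = 0" "spline_C \<beta> 0 = 0"
  by (simp_all add: spline_D_def spline_A_def spline_B_def spline_C_def)

text \<open>Taylor's formula for the primitives across one cell, which confirms the closed forms.\<close>

lemma spline_Suc:
  "spline_A \<beta> (Suc n) = spline_A \<beta> n + spline_D \<beta> n"
  "spline_B \<beta> (Suc n) = spline_B \<beta> n + spline_A \<beta> n + spline_D \<beta> n / 2"
  "spline_C \<beta> (Suc n) = spline_C \<beta> n + spline_B \<beta> n + spline_A \<beta> n / 2 + spline_D \<beta> n / 6"
proof -
  have 1: "rising \<beta> (Suc n) = rising (\<beta> - 1) (Suc n) + rising \<beta> n"
    and 2: "rising (\<beta> + 1) (Suc n) = rising \<beta> (Suc n) + rising (\<beta> + 1) n"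
    and 3: "rising (\<beta> + 2) (Suc n) = rising (\<beta> + 1) (Suc n) + rising (\<beta> + 2) n"
    using rising_diff[of \<beta> n] rising_diff[of "\<beta> + 1" n] rising_diff[of "\<beta> + 2" n]
    by (simp_all add: add.commute)
  show "spline_A \<beta> (Suc n) = spline_A \<beta> n + spline_D \<beta> n"
    unfolding spline_A_def spline_D_def using 1 by linarith
  show "spline_B \<beta> (Suc n) = spline_B \<beta> n + spline_A \<beta> n + spline_D \<beta> n / 2"
    unfolding spline_A_def spline_B_def spline_D_def using 1 2 by (simp add: field_simps)
  show "spline_C \<beta> (Suc n) = spline_C \<beta> n + spline_B \<beta> n + spline_A \<beta> n / 2 + spline_D \<beta> n / 6"
    unfolding spline_A_def spline_B_def spline_C_def spline_D_def using 1 2 3 by (simp add: field_simps)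
qed

text \<open>The third primitive of the step function, at \<open>n + \<tau>\<close>, is subtracted from the function it should approximate. The latter
  is the second primitive of the kernel \<open>\<kappa> t = t powr (\<beta> - 1) / Gamma \<beta>\<close> minus \<open>\<alpha> / 2 = (2 - \<beta>) / 2\<close> times its
  first primitive; the second term accounts for the first-order error of the Grunwald formula.\<close>

definition kernel_error :: "real \<Rightarrow> nat \<Rightarrow> real \<Rightarrow> real" where
  "kernel_error \<beta> n \<tau> = (n + \<tau>) powr (\<beta> + 1) / Gamma (\<beta> + 2) - (2 - \<beta>) / 2 * (n + \<tau>) powr \<beta> / Gamma (\<beta> + 1)
     - (spline_C \<beta> n + spline_B \<beta> n * \<tau> + spline_A \<beta> n * \<tau>\<^sup>2 / 2 + spline_D \<beta> n * \<tau> ^ 3 / 6)"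

lemma Gamma_plus_12:
  fixes \<beta> :: real
  assumes "\<beta> > 0"
  shows "Gamma (\<beta> + 1) = \<beta> * Gamma \<beta>" "Gamma (\<beta> + 2) = \<beta> * (\<beta> + 1) * Gamma \<beta>"
proof -
  have nn: "\<beta> \<notin> \<int>\<^sub>\<le>\<^sub>0" "\<beta> + 1 \<notin> \<int>\<^sub>\<le>\<^sub>0" using assms by auto
  show 1: "Gamma (\<beta> + 1) = \<beta> * Gamma \<beta>" using Gamma_plus1[OF nn(1)] .
  show "Gamma (\<beta> + 2) = \<beta> * (\<beta> + 1) * Gamma \<beta>"
    using Gamma_plus1[OF nn(2)] 1 by (simp add: add.assoc)
qed

text \<open>On the first cell all terms are bounded, whereas \<open>\<tau> powr (\<beta> - 1)\<close> is at least 1.\<close>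

lemma kernel_error_first_cell:
  assumes \<beta>: "0 < \<beta>" "\<beta> < 1" and \<tau>: "0 < \<tau>" "\<tau> \<le> 1"
  shows "\<bar>kernel_error \<beta> 0 \<tau>\<bar> \<le> (1 / Gamma (\<beta> + 2) + 1 / Gamma (\<beta> + 1) + 1) * \<tau> powr (\<beta> - 1)"
proof -
  have G: "Gamma (\<beta> + 2) > 0" "Gamma (\<beta> + 1) > 0" using \<beta> by (auto intro!: Gamma_real_pos)
  have p: "0 \<le> \<tau> powr q" "\<tau> powr q \<le> 1" if "q > 0" for q
    using \<tau> that powr_le1[of q \<tau>] by auto
  have "0 \<le> \<tau> powr (\<beta> + 1) / Gamma (\<beta> + 2)" "\<tau> powr (\<beta> + 1) / Gamma (\<beta> + 2) \<le> 1 / Gamma (\<beta> + 2)"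
    using p[of "\<beta> + 1"] \<beta> G by (auto intro: divide_right_mono)
  moreover have "(2 - \<beta>) / 2 * \<tau> powr \<beta> \<le> 1" using p[of \<beta>] \<beta> by (intro mult_le_one) auto
  then have "0 \<le> (2 - \<beta>) / 2 * \<tau> powr \<beta> / Gamma (\<beta> + 1)"
      "(2 - \<beta>) / 2 * \<tau> powr \<beta> / Gamma (\<beta> + 1) \<le> 1 / Gamma (\<beta> + 1)"
    using p[of \<beta>] \<beta> G divide_right_mono[of "(2 - \<beta>) / 2 * \<tau> powr \<beta>" 1 "Gamma (\<beta> + 1)"] by auto
  moreover have "0 \<le> \<tau> ^ 3 / 6" "\<tau> ^ 3 / 6 \<le> 1" using \<tau> power_le_one[of \<tau> 3] by auto
  moreover have "kernel_error \<beta> 0 \<tau> = \<tau> powr (\<beta> + 1) / Gamma (\<beta> + 2)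
      - (2 - \<beta>) / 2 * \<tau> powr \<beta> / Gamma (\<beta> + 1) - \<tau> ^ 3 / 6"
    by (simp add: kernel_error_def)
  ultimately have "\<bar>kernel_error \<beta> 0 \<tau>\<bar> \<le> 1 / Gamma (\<beta> + 2) + 1 / Gamma (\<beta> + 1) + 1"
    by linarith
  also have "\<dots> = (1 / Gamma (\<beta> + 2) + 1 / Gamma (\<beta> + 1) + 1) * 1" by simp
  also have "\<dots> \<le> (1 / Gamma (\<beta> + 2) + 1 / Gamma (\<beta> + 1) + 1) * \<tau> powr (\<beta> - 1)"
  proof (rule mult_left_mono)
    have "1 powr (\<beta> - 1) \<le> \<tau> powr (\<beta> - 1)" using \<tau> \<beta> by (intro powr_mono2') auto
    then show "1 \<le> \<tau> powr (\<beta> - 1)" by simp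
  qed (use G in simp)
  finally show ?thesis .
qed

lemma one_plus_powr_le:
  fixes x p :: real
  assumes "0 \<le> x" "0 \<le> p" "p \<le> 1"
  shows "(1 + x) powr p \<le> 1 + p * x"
  using Youngs_inequality_0[of "1 - p" p 1 "1 + x"] assms by (simp add: algebra_simps)

lemma one_plus_powr_ge:
  fixes x p :: real
  assumes "0 \<le> x" "0 \<le> p" "p \<le> 1"
  shows "1 + p * x - x\<^sup>2 \<le> (1 + x) powr p"
proof -
  have "1 + p * x - x\<^sup>2 \<le> 1 + p * x - p * (1 - p) * x\<^sup>2"
    using assms mult_right_mono[of "p * (1 - p)" 1 "x\<^sup>2"] mult_le_one[of p "1 - p"] by simp
  also have "\<dots> \<le> (1 + x) / (1 + (1 - p) * x)"
  proof -
    have "(1 + p * x - p * (1 - p) * x\<^sup>2) * (1 + (1 - p) * x) = 1 + x - p * (1 - p) * (1 - p) * x ^ 3"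
      by (simp add: algebra_simps power2_eq_square power3_eq_cube)
    also have "\<dots> \<le> 1 + x" using assms by simp
    finally show ?thesis using assms by (subst pos_le_divide_eq) (auto intro: add_pos_nonneg)
  qed
  also have "\<dots> \<le> (1 + x) / (1 + x) powr (1 - p)"
    using assms one_plus_powr_le[of x "1 - p"]
    by (intro divide_left_mono mult_pos_pos) (auto intro: add_pos_nonneg)
  also have "\<dots> = (1 + x) powr p"
    using assms by (simp add: powr_diff field_simps)
  finally show ?thesis .
qed

lemma abs_mult_le:
  fixes a b A B :: real
  assumes "\<bar>a\<bar> \<le> A" "\<bar>b\<bar> \<le> B"
  shows "\<bar>a * b\<bar> \<le> A * B"
  using assms by (simp add: abs_mult mult_mono)

text \<open>The powers are of orders \<open>n powr (\<beta> + 1)\<close> and \<open>n powr \<beta>\<close>, but these orders cancel against the spline. All node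
  values are \<open>rising \<beta> n\<close> times a rational function of \<open>n\<close>, so that the second-order expansion of
  this single sequence is enough.\<close>

lemma kernel_error_later_cells:
  assumes \<beta>: "0 < \<beta>" "\<beta> < 1"
  obtains M where "\<And>n \<tau>. n \<ge> 1 \<Longrightarrow> 0 \<le> \<tau> \<Longrightarrow> \<tau> \<le> 1 \<Longrightarrow> \<bar>kernel_error \<beta> n \<tau>\<bar> \<le> M * real n powr (\<beta> - 1)"
proof -
  define G where "G = Gamma \<beta>"
  have G: "G > 0" using \<beta> by (auto simp: G_def intro: Gamma_real_pos)
  define d where "d = \<beta> * (\<beta> - 1) / 2"
  have d: "\<bar>d\<bar> \<le> 1"
  proof -
    have "\<beta> * (1 - \<beta>) \<le> 1" "\<beta> * (1 - \<beta>) \<ge> 0" using \<beta> by (auto intro: mult_le_one)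
    moreover have "d = - (\<beta> * (1 - \<beta>)) / 2" by (simp add: d_def algebra_simps)
    ultimately show ?thesis by linarith
  qed
  obtain K where K: "K \<ge> 0" and asym: "\<And>n. n \<ge> 1 \<Longrightarrow>
    \<bar>rising \<beta> n * G / real n powr (\<beta> - 1) - 1 - d / real n\<bar> \<le> K / real n ^ 2"
    using rising_asymptotics_bound[OF \<beta>(1)] unfolding d_def G_def by metis
  define M where "M = 100 * (2 + K) / (\<beta> * (\<beta> + 1) * G)"
  show thesis
  proof (rule that[of M])
    fix n :: nat and \<tau> :: real
    assume n: "n \<ge> 1" and \<tau>: "0 \<le> \<tau>" "\<tau> \<le> 1"
    define N where "N = real n"
    have N: "N \<ge> 1" using n by (simp add: N_def)
    define y where "y = N powr (\<beta> - 1)"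
    have y: "y > 0" using N by (simp add: y_def)
    (* Everything is measured in units of y / Gamma \<beta>. The function F is the part of N * (\<omega> - 1) left over
       by the asymptotic expansion of the Gamma quotient; the expansion makes even N * F bounded. *)
    define \<omega> where "\<omega> = rising \<beta> n * G / y"
    define F where "F = N * (\<omega> - 1) - d"
    have rF: "\<bar>\<omega> - 1 - d / N\<bar> \<le> K / N ^ 2" using asym[OF n] by (simp add: \<omega>_def y_def N_def)
    have Feq: "F = N * (\<omega> - 1 - d / N)" using N by (simp add: F_def field_simps)
    have NF: "\<bar>N * F\<bar> \<le> K"
    proof -
      have "\<bar>N * F\<bar> = N ^ 2 * \<bar>\<omega> - 1 - d / N\<bar>" using N by (simp add: Feq abs_mult power2_eq_square)
      also have "\<dots> \<le> N ^ 2 * (K / N ^ 2)" using rF by (intro mult_left_mono) auto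
      finally show ?thesis using N by simp
    qed
    have F: "\<bar>F\<bar> \<le> K" using NF N mult_right_mono[of 1 N "\<bar>F\<bar>"] by (simp add: abs_mult)
    have \<omega>: "\<bar>\<omega>\<bar> \<le> 2 + K"
    proof -
      have "\<omega> - 1 = (d + F) / N" using N by (simp add: F_def field_simps)
      then have "\<bar>\<omega> - 1\<bar> = \<bar>(d + F) / N\<bar>" by simp
      also have "\<bar>(d + F) / N\<bar> \<le> (1 + K) / 1"
        unfolding abs_divide using d F N K by (intro frac_le) auto
      finally show ?thesis by simp
    qed
    have \<omega>N: "N * \<omega> = N + d + F" by (simp add: F_def algebra_simps)
    define \<delta> where "\<delta> = rising (\<beta> - 1) n * G / y"
    have \<delta>eq: "(\<beta> - 1) * \<omega> = (\<beta> - 1 + N) * \<delta>"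
    proof -
      have "(\<beta> - 1) * \<omega> = ((\<beta> - 1) * rising \<beta> n) * G / y" by (simp add: \<omega>_def)
      also have "(\<beta> - 1) * rising \<beta> n = (\<beta> - 1 + N) * rising (\<beta> - 1) n"
        using rising_shift[of "\<beta> - 1" n] by (simp add: N_def)
      finally show ?thesis by (simp add: \<delta>_def)
    qed
    have \<delta>: "\<beta> * \<bar>\<delta>\<bar> \<le> 2 + K"
    proof -
      have "\<beta> * \<bar>\<delta>\<bar> \<le> \<bar>\<beta> - 1 + N\<bar> * \<bar>\<delta>\<bar>" using N \<beta> by (intro mult_right_mono) auto
      also have "\<dots> = \<bar>\<beta> - 1\<bar> * \<bar>\<omega>\<bar>" using \<delta>eq by (metis abs_mult)
      also have "\<dots> \<le> 1 * (2 + K)" using \<omega> \<beta> by (intro mult_mono) auto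
      finally show ?thesis by simp
    qed
    have W1: "\<beta> * (rising (\<beta> + 1) n * G / y) = (\<beta> + N) * \<omega>"
    proof -
      have "\<beta> * (rising (\<beta> + 1) n * G / y) = (\<beta> * rising (\<beta> + 1) n) * G / y" by simp
      also have "\<beta> * rising (\<beta> + 1) n = (\<beta> + N) * rising \<beta> n"
        by (simp add: rising_shift N_def)
      finally show ?thesis by (simp add: \<omega>_def)
    qed
    have W2: "\<beta> * (\<beta> + 1) * (rising (\<beta> + 2) n * G / y) = (\<beta> + 1 + N) * (\<beta> + N) * \<omega>"
    proof -
      have "\<beta> * (\<beta> + 1) * (rising (\<beta> + 2) n * G / y) = \<beta> * ((\<beta> + 1) * rising (\<beta> + 2) n) * G / y"
        by (simp only: times_divide_eq_right mult.assoc)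
      also have "(\<beta> + 1) * rising (\<beta> + 2) n = (\<beta> + 1 + N) * rising (\<beta> + 1) n"
        using rising_shift[of "\<beta> + 1" n] by (simp add: N_def add.assoc)
      also have "\<beta> * ((\<beta> + 1 + N) * rising (\<beta> + 1) n) * G / y
          = (\<beta> + 1 + N) * (\<beta> * (rising (\<beta> + 1) n * G / y))"
        by (simp only: times_divide_eq_right mult.assoc mult.left_commute)
      finally show ?thesis by (simp only: W1 mult.assoc)
    qed
    (* E1 and E2 are the remainders of the expansions of (N + \<tau>) powr (\<beta> + 1) and (N + \<tau>) powr \<beta> at N. *)
    define x where "x = \<tau> / N"
    have x: "0 \<le> x" "x \<le> 1" using \<tau> N by (auto simp: x_def divide_le_eq)
    have Nx: "N * x = \<tau>" using N by (simp add: x_def)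
    have split: "(N + \<tau>) powr p = N powr p * (1 + x) powr p" for p
      using N x by (subst powr_mult[symmetric]) (auto simp: algebra_simps Nx)
    define E2 where "E2 = N * ((1 + x) powr \<beta> - 1)"
    define E1 where "E1 = N * (N * ((1 + x) powr \<beta> - 1 - \<beta> * x))"
    have E2: "0 \<le> E2" "E2 \<le> 1"
    proof -
      have "1 \<le> (1 + x) powr \<beta>" using x \<beta> by (intro ge_one_powr_ge_zero) auto
      then show "0 \<le> E2" using N by (simp add: E2_def)
      have "E2 \<le> N * (\<beta> * x)" unfolding E2_def using one_plus_powr_le[of x \<beta>] x \<beta> N by (intro mult_left_mono) auto
      also have "\<dots> = \<beta> * \<tau>" using Nx by simp
      also have "\<dots> \<le> 1" using \<beta> \<tau> by (intro mult_le_one) auto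
      finally show "E2 \<le> 1" .
    qed
    have E1: "\<bar>E1\<bar> \<le> 1"
    proof -
      have "\<bar>(1 + x) powr \<beta> - 1 - \<beta> * x\<bar> \<le> x\<^sup>2"
        using one_plus_powr_le[of x \<beta>] one_plus_powr_ge[of x \<beta>] x \<beta> zero_le_power2[of x] unfolding abs_le_iff by linarith
      then have "\<bar>E1\<bar> \<le> N * (N * x\<^sup>2)" unfolding E1_def using N by (simp add: abs_mult)
      also have "\<dots> = \<tau>\<^sup>2" using Nx by (metis mult.assoc mult.left_commute power2_eq_square)
      also have "\<dots> \<le> 1" using \<tau> by (simp add: power_le_one)
      finally show ?thesis .
    qed
    have s2: "(N + \<tau>) powr \<beta> = y * (N + E2)"
      using N by (simp add: split y_def E2_def powr_diff field_simps)
    have s1: "(N + \<tau>) powr (\<beta> + 1) = y * (N\<^sup>2 + (1 + \<beta>) * \<tau> * N + E1 + \<tau> * E2)"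
    proof -
      have "(N + \<tau>) powr (\<beta> + 1) = (N + \<tau>) * (N + \<tau>) powr \<beta>" using N \<tau> by (simp add: powr_add)
      also have "\<dots> = y * ((N + \<tau>) * (N + E2))" by (simp add: s2)
      also have "(N + \<tau>) * (N + E2) = N\<^sup>2 + \<tau> * N + \<tau> * E2 + N * E2" by (simp add: algebra_simps power2_eq_square)
      also have "N * E2 = E1 + \<beta> * N * \<tau>" by (simp add: E1_def E2_def algebra_simps flip: Nx)
      finally show ?thesis by (simp add: algebra_simps)
    qed
    define X where "X = d + F"
    define Y where "Y = \<beta> * (\<beta> + 1) * \<omega>"
    define Z where "Z = (\<beta> + 1) * (\<beta> * \<delta>)"
    (* After multiplication by \<beta> * (\<beta> + 1) * G / y the terms in N^2 and in N cancel, the latter because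
       of the values of d and of the coefficient (2 - \<beta>) / 2. R collects the rest, which is bounded. *)
    define R where "R = E1 + \<tau> * E2 - ((\<beta> + 1) * (2 - \<beta>) / 2) * E2 - N * F - (2 * \<beta> + 1) * X - Y
        + 2 * ((\<beta> + 1) * X) + 2 * Y - 7 / 6 * Y + Z / 6
        - \<tau> * ((\<beta> + 1) * X) + (\<tau> * Y) / 2 - (\<tau> * Z) / 2 - (\<tau>\<^sup>2 * Y) / 2 + (\<tau>\<^sup>2 * Z) / 2 - (\<tau> ^ 3 * Z) / 6"
    have expand: "kernel_error \<beta> n \<tau> * (\<beta> * (\<beta> + 1) * G) / y = R"
    proof -
      let ?g = "\<beta> * (\<beta> + 1) * G"
      have D: "spline_D \<beta> n * ?g / y = Z"
        by (simp add: spline_D_def Z_def \<delta>_def)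
      have A: "spline_A \<beta> n * ?g / y = Y - Z"
        by (simp add: spline_A_def Y_def Z_def \<delta>_def \<omega>_def algebra_simps diff_divide_distrib add_divide_distrib)
      have "spline_B \<beta> n * ?g / y = (\<beta> + 1) * (\<beta> * (rising (\<beta> + 1) n * G / y)) - 3 / 2 * Y + Z / 2"
        by (simp add: spline_B_def Y_def Z_def \<delta>_def \<omega>_def algebra_simps diff_divide_distrib add_divide_distrib)
      then have B: "spline_B \<beta> n * ?g / y = (\<beta> + 1) * (N + X) - Y / 2 + Z / 2"
        unfolding W1 Y_def using \<omega>N by (simp add: X_def algebra_simps add_divide_distrib)
      have "spline_C \<beta> n * ?g / y = \<beta> * (\<beta> + 1) * (rising (\<beta> + 2) n * G / y)
          - 2 * ((\<beta> + 1) * (\<beta> * (rising (\<beta> + 1) n * G / y))) + 7 / 6 * Y - Z / 6"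
        by (simp add: spline_C_def Y_def Z_def \<delta>_def \<omega>_def algebra_simps diff_divide_distrib add_divide_distrib)
      also have "\<dots> = N * (N * \<omega>) - N * \<omega> - \<beta> * (\<beta> + 1) * \<omega> + 7 / 6 * Y - Z / 6"
        unfolding W1 W2 by (simp add: algebra_simps)
      also have "\<dots> = N\<^sup>2 + d * N + N * F - N - X + Y / 6 - Z / 6"
        unfolding \<omega>N Y_def X_def by (simp add: algebra_simps power2_eq_square add_divide_distrib)
      finally have C: "spline_C \<beta> n * ?g / y = N\<^sup>2 + d * N + N * F - N - X + Y / 6 - Z / 6" .
      have t1: "(N + \<tau>) powr (\<beta> + 1) / Gamma (\<beta> + 2) * ?g = (N + \<tau>) powr (\<beta> + 1)"
        using \<beta> G by (simp add: Gamma_plus_12 flip: G_def)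
      have t2: "(2 - \<beta>) / 2 * (N + \<tau>) powr \<beta> / Gamma (\<beta> + 1) * ?g = (2 - \<beta>) * (\<beta> + 1) / 2 * (N + \<tau>) powr \<beta>"
        using \<beta> G by (simp add: Gamma_plus_12 flip: G_def)
      have "(a - b - (p + q * \<tau> + r * \<tau>\<^sup>2 / 2 + t * \<tau> ^ 3 / 6)) * g / y
          = a * g / y - b * g / y - (p * g / y + (q * g / y) * \<tau> + (r * g / y) * \<tau>\<^sup>2 / 2 + (t * g / y) * \<tau> ^ 3 / 6)"
        for a b p q r t g
        by (simp add: algebra_simps add_divide_distrib diff_divide_distrib)
      from this[where g = ?g]
      have "kernel_error \<beta> n \<tau> * ?g / y = (N + \<tau>) powr (\<beta> + 1) / y - (2 - \<beta>) * (\<beta> + 1) / 2 * ((N + \<tau>) powr \<beta> / y)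
         - (spline_C \<beta> n * ?g / y + (spline_B \<beta> n * ?g / y) * \<tau> + (spline_A \<beta> n * ?g / y) * \<tau>\<^sup>2 / 2
            + (spline_D \<beta> n * ?g / y) * \<tau> ^ 3 / 6)"
        unfolding kernel_error_def N_def[symmetric] by (simp only: t1 t2 times_divide_eq_right)
      also have "\<dots> = R"
        unfolding A B C D s1 s2 R_def using y by (simp add: d_def) (simp add: field_simps power2_eq_square power3_eq_cube)
      finally show ?thesis .
    qed
    (* Each term is at most a small multiple of 2 + K; the factor 100 is generous. *)
    have R: "\<bar>R\<bar> \<le> 100 * (2 + K)"
    proof -
      have X: "\<bar>X\<bar> \<le> 1 + K" using d F unfolding X_def by linarith
      have b: "\<bar>\<beta> * (\<beta> + 1)\<bar> \<le> 2" "\<bar>(\<beta> + 1) * (2 - \<beta>) / 2\<bar> \<le> 2"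
        using \<beta> abs_mult_le[of \<beta> 1 "\<beta> + 1" 2] abs_mult_le[of "\<beta> + 1" 2 "2 - \<beta>" 2] by auto
      have Y: "\<bar>Y\<bar> \<le> 2 * (2 + K)" unfolding Y_def by (rule abs_mult_le[OF b(1) \<omega>])
      have Z: "\<bar>Z\<bar> \<le> 2 * (2 + K)"
        unfolding Z_def using \<beta> \<delta> by (intro abs_mult_le) (auto simp: abs_mult)
      have t: "\<bar>\<tau>\<bar> \<le> 1" "\<bar>\<tau>\<^sup>2\<bar> \<le> 1" "\<bar>\<tau> ^ 3\<bar> \<le> 1"
        using \<tau> by (auto simp: power_le_one)
      have E2': "\<bar>E2\<bar> \<le> 1" using E2 by simp
      have X': "\<bar>(\<beta> + 1) * X\<bar> \<le> 2 * (1 + K)" "\<bar>(2 * \<beta> + 1) * X\<bar> \<le> 3 * (1 + K)"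
        by (rule abs_mult_le[OF _ X]; use \<beta> in simp)+
      define x1 x2 x3 x4 x5 y1 y2 z1 z2 z3 where
        "x1 = \<tau> * E2" "x2 = ((\<beta> + 1) * (2 - \<beta>) / 2) * E2" "x3 = (2 * \<beta> + 1) * X" "x4 = (\<beta> + 1) * X"
        "x5 = \<tau> * x4" "y1 = \<tau> * Y" "y2 = \<tau>\<^sup>2 * Y" "z1 = \<tau> * Z" "z2 = \<tau>\<^sup>2 * Z" "z3 = \<tau> ^ 3 * Z"
      note defs = this
      have bounds: "\<bar>x1\<bar> \<le> 1" "\<bar>x2\<bar> \<le> 2" "\<bar>x3\<bar> \<le> 3 * (1 + K)" "\<bar>x4\<bar> \<le> 2 * (1 + K)"
        "\<bar>x5\<bar> \<le> 2 * (1 + K)" "\<bar>y1\<bar> \<le> 2 * (2 + K)" "\<bar>y2\<bar> \<le> 2 * (2 + K)"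
        "\<bar>z1\<bar> \<le> 2 * (2 + K)" "\<bar>z2\<bar> \<le> 2 * (2 + K)" "\<bar>z3\<bar> \<le> 2 * (2 + K)"
        using abs_mult_le[OF t(1) E2'] abs_mult_le[OF b(2) E2'] X' abs_mult_le[OF t(1) X'(1)]
        abs_mult_le[OF t(1) Y] abs_mult_le[OF t(1) Z] abs_mult_le[OF t(2) Y] abs_mult_le[OF t(2) Z] abs_mult_le[OF t(3) Z]
        unfolding defs mult_1 mult_1_right by blast+
      have "R = E1 + x1 - x2 - N * F - x3 - Y + 2 * x4 + 2 * Y - 7 / 6 * Y + Z / 6
          - x5 + y1 / 2 - z1 / 2 - y2 / 2 + z2 / 2 - z3 / 6"
        unfolding R_def defs ..
      moreover note bounds[THEN abs_le_D1] bounds[THEN abs_le_D2] E1[THEN abs_le_D1] E1[THEN abs_le_D2]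
          NF[THEN abs_le_D1] NF[THEN abs_le_D2] Y[THEN abs_le_D1] Y[THEN abs_le_D2]
          Z[THEN abs_le_D1] Z[THEN abs_le_D2] K
      ultimately show ?thesis unfolding distrib_left by (intro abs_leI) linarith+
    qed
    have "\<bar>kernel_error \<beta> n \<tau>\<bar> = \<bar>R\<bar> * y / (\<beta> * (\<beta> + 1) * G)"
    proof -
      have "kernel_error \<beta> n \<tau> = R * y / (\<beta> * (\<beta> + 1) * G)"
        unfolding expand[symmetric] using \<beta> G y by simp
      then show ?thesis using \<beta> G y by (simp add: abs_mult)
    qed
    also have "\<dots> \<le> 100 * (2 + K) * y / (\<beta> * (\<beta> + 1) * G)"
      using R \<beta> G y by (intro divide_right_mono mult_right_mono) auto
    finally show "\<bar>kernel_error \<beta> n \<tau>\<bar> \<le> M * real n powr (\<beta> - 1)"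
      by (simp add: M_def y_def N_def)
  qed
qed

text \<open>The bound is a multiple of the kernel itself, also near the singularity at 0. This is why the error of the
  Grunwald formula becomes a Weyl integral of the fourth derivative.\<close>

lemma kernel_error_bound:
  assumes \<beta>: "0 < \<beta>" "\<beta> < 1"
  obtains K where "K \<ge> 0" and "\<And>n \<tau>. 0 \<le> \<tau> \<Longrightarrow> \<tau> \<le> 1 \<Longrightarrow> real n + \<tau> > 0 \<Longrightarrow>
    \<bar>kernel_error \<beta> n \<tau>\<bar> \<le> K * (n + \<tau>) powr (\<beta> - 1)"
proof -
  obtain M where M: "\<And>n \<tau>. n \<ge> 1 \<Longrightarrow> 0 \<le> \<tau> \<Longrightarrow> \<tau> \<le> 1 \<Longrightarrow> \<bar>kernel_error \<beta> n \<tau>\<bar> \<le> M * real n powr (\<beta> - 1)"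
    using kernel_error_later_cells[OF \<beta>] by blast
  define K where "K = (1 / Gamma (\<beta> + 2) + 1 / Gamma (\<beta> + 1) + 1) + 2 * \<bar>M\<bar>"
  have G: "Gamma (\<beta> + 2) > 0" "Gamma (\<beta> + 1) > 0" using \<beta> by (auto intro!: Gamma_real_pos)
  show thesis
  proof (rule that[of K])
    fix n :: nat and \<tau> :: real
    assume \<tau>: "0 \<le> \<tau>" "\<tau> \<le> 1" "real n + \<tau> > 0"
    show "\<bar>kernel_error \<beta> n \<tau>\<bar> \<le> K * (n + \<tau>) powr (\<beta> - 1)"
    proof (cases "n = 0")
      case True
      then have "\<bar>kernel_error \<beta> n \<tau>\<bar> \<le> (1 / Gamma (\<beta> + 2) + 1 / Gamma (\<beta> + 1) + 1) * \<tau> powr (\<beta> - 1)"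
        using kernel_error_first_cell[OF \<beta>] \<tau> by simp
      also have "\<dots> \<le> K * \<tau> powr (\<beta> - 1)" unfolding K_def by (intro mult_right_mono) auto
      finally show ?thesis using True by simp
    next
      case False
      then have n: "n \<ge> 1" by simp
      have "(1/2) * real n powr (\<beta> - 1) \<le> 2 powr (\<beta> - 1) * real n powr (\<beta> - 1)"
        using powr_mono[of "-1" "\<beta> - 1" 2] \<beta> by (intro mult_right_mono) (auto simp: powr_minus)
      also have "\<dots> = (2 * real n) powr (\<beta> - 1)" by (simp add: powr_mult)
      also have "\<dots> \<le> (n + \<tau>) powr (\<beta> - 1)" using \<tau> \<beta> n by (intro powr_mono2') auto
      finally have *: "real n powr (\<beta> - 1) \<le> 2 * (n + \<tau>) powr (\<beta> - 1)" by simp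
      have "\<bar>kernel_error \<beta> n \<tau>\<bar> \<le> M * real n powr (\<beta> - 1)" using M n \<tau> by blast
      also have "\<dots> \<le> \<bar>M\<bar> * real n powr (\<beta> - 1)" by (intro mult_right_mono) auto
      also have "\<dots> \<le> \<bar>M\<bar> * (2 * (n + \<tau>) powr (\<beta> - 1))" using * by (intro mult_left_mono) auto
      also have "\<dots> = (2 * \<bar>M\<bar>) * (n + \<tau>) powr (\<beta> - 1)" by simp
      also have "\<dots> \<le> K * (n + \<tau>) powr (\<beta> - 1)"
        unfolding K_def using G by (intro mult_right_mono) auto
      finally show ?thesis .
    qed
  qed (use G in \<open>simp add: K_def\<close>)
qed

text \<open>Needed for the boundary terms only: the first primitives of the exact and the discrete kernel stay at bounded distance.\<close>

lemma spline_B_error_bounded: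
  assumes \<beta>: "0 < \<beta>" "\<beta> < 1"
  obtains M where "\<And>n. \<bar>real n powr \<beta> / Gamma (\<beta> + 1) - spline_B \<beta> n\<bar> \<le> M"
proof -
  have pos: "\<beta> + 1 > 0" using \<beta> by simp
  obtain K where K: "K \<ge> 0" and asym: "\<And>n. n \<ge> 1 \<Longrightarrow>
    \<bar>rising (\<beta> + 1) n * Gamma (\<beta> + 1) / real n powr \<beta> - 1 - (\<beta> + 1) * \<beta> / 2 / real n\<bar> \<le> K / real n ^ 2"
    using rising_asymptotics_bound[OF pos] by (metis add_diff_cancel_right')
  have G: "Gamma (\<beta> + 1) > 0" using \<beta> by (auto intro!: Gamma_real_pos)
  define M where "M = 2 + (1 + K) / Gamma (\<beta> + 1)"
  have "\<bar>real n powr \<beta> / Gamma (\<beta> + 1) - spline_B \<beta> n\<bar> \<le> M" for n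
  proof (cases "n = 0")
    case True
    then show ?thesis using K G by (simp add: M_def)
  next
    case False
    define N where "N = real n"
    have N: "N \<ge> 1" using False by (simp add: N_def)
    define r where "r = rising (\<beta> + 1) n * Gamma (\<beta> + 1) / N powr \<beta> - 1"
    have "\<bar>r\<bar> \<le> (1 + K) / N"
    proof -
      have "K / N ^ 2 \<le> K / N" using N K by (intro divide_left_mono) (auto simp: power2_eq_square)
      moreover have "(\<beta> + 1) * \<beta> / 2 / N \<le> 1 / N"
        using N \<beta> mult_mono[of "\<beta> + 1" 2 \<beta> 1] by (intro divide_right_mono) auto
      moreover have "0 \<le> (\<beta> + 1) * \<beta> / 2 / N" using N \<beta> by auto
      moreover have "\<bar>r - (\<beta> + 1) * \<beta> / 2 / N\<bar> \<le> K / N ^ 2" using asym[of n] False by (simp add: r_def N_def)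
      ultimately show ?thesis unfolding add_divide_distrib by linarith
    qed
    moreover have "N powr \<beta> \<le> N powr 1" using N \<beta> by (intro powr_mono) auto
    ultimately have "N powr \<beta> * \<bar>r\<bar> \<le> N * ((1 + K) / N)"
      using N by (intro mult_mono) auto
    then have r: "\<bar>N powr \<beta> * r\<bar> \<le> 1 + K" using N by (simp add: abs_mult)
    have "rising (\<beta> + 1) n = (N powr \<beta> + N powr \<beta> * r) / Gamma (\<beta> + 1)"
      using N G by (simp add: r_def field_simps)
    then have "N powr \<beta> / Gamma (\<beta> + 1) - spline_B \<beta> n
        = - (N powr \<beta> * r / Gamma (\<beta> + 1)) + 3 / 2 * rising \<beta> n - rising (\<beta> - 1) n / 2"
      by (simp add: spline_B_def add_divide_distrib)
    moreover have "\<bar>N powr \<beta> * r / Gamma (\<beta> + 1)\<bar> \<le> (1 + K) / Gamma (\<beta> + 1)"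
      using r G by (simp add: divide_right_mono)
    moreover have "\<bar>rising \<beta> n\<bar> \<le> 1" "\<bar>rising (\<beta> - 1) n\<bar> \<le> 1"
      using \<beta> by (auto intro!: abs_rising_le_1)
    ultimately show ?thesis unfolding M_def N_def by linarith
  qed
  then show thesis by (rule that)
qed

section \<open>Functions integrable together with their derivatives\<close>

lemma set_integrable_subset_lborel:
  fixes f :: "real \<Rightarrow> real"
  assumes "integrable lborel f" "S \<in> sets borel"
  shows "set_integrable lborel S f"
  unfolding set_integrable_def using assms by (intro integrable_mult_indicator) auto

text \<open>The derivative need not be continuous; integrability suffices. This matters for the fourth derivative of \<open>u\<close>, whose
  derivative is only assumed to exist and to be integrable.\<close>

lemma ftc_lborel:
  fixes f f' :: "real \<Rightarrow> real"
  assumes "\<And>t. (f has_real_derivative f' t) (at t)" "integrable lborel f'" "x \<le> y"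
  shows "f y - f x = (LINT t:{x..y}|lborel. f' t)"
proof -
  have "(f' has_integral (f y - f x)) {x..y}"
    using assms(1,3) by (intro fundamental_theorem_of_calculus)
      (auto intro: has_field_derivative_at_within simp flip: has_real_derivative_iff_has_vector_derivative)
  moreover have "set_integrable lborel {x..y} f'"
    using assms(2) by (intro set_integrable_subset_lborel) auto
  ultimately show ?thesis
    using set_borel_integral_eq_integral(2)[of "{x..y}" f'] by (simp add: integral_unique)
qed

text \<open>Both the boundedness and the decay of a function that is integrable together with its derivative follow from this local
  estimate.\<close>

lemma abs_value_le_average:
  fixes f f' :: "real \<Rightarrow> real"
  assumes der: "\<And>t. (f has_real_derivative f' t) (at t)"
    and int: "integrable lborel f" "integrable lborel f'"
  shows "\<bar>f x\<bar> \<le> (LINT t:{x..x + 1}|lborel. \<bar>f t\<bar> + \<bar>f' t\<bar>)"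
proof -
  let ?I = "{x..x + 1}"
  define A where "A = (LINT t:?I|lborel. \<bar>f' t\<bar>)"
  have si: "set_integrable lborel S (\<lambda>t. \<bar>f t\<bar>)" "set_integrable lborel S (\<lambda>t. \<bar>f' t\<bar>)"
    if "S \<in> sets borel" for S
    using int that by (auto intro!: set_integrable_subset_lborel)
  have sc: "set_integrable lborel ?I (\<lambda>t. c)" for c :: real
    unfolding set_integrable_def by simp
  (* From x to any y of the interval, f changes by at most A; it remains to average over y. *)
  have near: "\<bar>f x\<bar> \<le> \<bar>f y\<bar> + A" if y: "y \<in> ?I" for y
  proof -
    have "\<bar>f y - f x\<bar> = \<bar>LINT t:{x..y}|lborel. f' t\<bar>"
      using ftc_lborel[OF der int(2)] y by simp
    also have "\<dots> \<le> (LINT t:{x..y}|lborel. \<bar>f' t\<bar>)"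
      using set_integral_norm_bound[OF set_integrable_subset_lborel[OF int(2), of "{x..y}"]] by simp
    also have "\<dots> \<le> A"
      unfolding A_def set_lebesgue_integral_def
      using si(2)[of "{x..y}"] si(2)[of ?I] y
      by (intro integral_mono) (auto simp: set_integrable_def indicator_def)
    finally show ?thesis by linarith
  qed
  have "\<bar>f x\<bar> = (LINT y:?I|lborel. \<bar>f x\<bar>)"
    by (simp add: set_lebesgue_integral_def)
  also have "\<dots> \<le> (LINT y:?I|lborel. \<bar>f y\<bar> + A)"
    using near si sc by (intro set_integral_mono) (auto intro!: set_integral_add)
  also have "\<dots> = (LINT y:?I|lborel. \<bar>f y\<bar>) + A"
    using si sc by (subst set_integral_add) (auto simp: set_lebesgue_integral_def)
  also have "\<dots> = (LINT t:?I|lborel. \<bar>f t\<bar> + \<bar>f' t\<bar>)"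
    unfolding A_def using si by (subst set_integral_add) auto
  finally show ?thesis .
qed

lemma abs_value_le_L1_norms:
  fixes f f' :: "real \<Rightarrow> real"
  assumes der: "\<And>t. (f has_real_derivative f' t) (at t)"
    and int: "integrable lborel f" "integrable lborel f'"
  shows "\<bar>f x\<bar> \<le> (LINT t|lborel. \<bar>f t\<bar> + \<bar>f' t\<bar>)"
proof -
  have "\<bar>f x\<bar> \<le> (LINT t:{x..x + 1}|lborel. \<bar>f t\<bar> + \<bar>f' t\<bar>)"
    by (rule abs_value_le_average[OF assms])
  also have "\<dots> \<le> (LINT t|lborel. \<bar>f t\<bar> + \<bar>f' t\<bar>)"
    unfolding set_lebesgue_integral_def using int
    by (intro integral_mono integrable_mult_indicator) (auto simp: indicator_def)
  finally show ?thesis .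
qed

lemma vanishes_at_infinity:
  fixes f f' :: "real \<Rightarrow> real"
  assumes der: "\<And>t. (f has_real_derivative f' t) (at t)"
    and int: "integrable lborel f" "integrable lborel f'"
  shows "(\<lambda>n. f (real n)) \<longlonglongrightarrow> 0"
proof -
  let ?g = "\<lambda>t. \<bar>f t\<bar> + \<bar>f' t\<bar>"
  have gi: "integrable lborel ?g" using int by auto
  have "(\<lambda>n. LINT t|lborel. indicator {real n..real n + 1} t *\<^sub>R ?g t) \<longlonglongrightarrow> (LINT (t :: real)|lborel. (0 :: real))"
  proof (rule integral_dominated_convergence[where w = ?g])
    show "AE t in lborel. (\<lambda>n. indicator {real n..real n + 1} t *\<^sub>R ?g t) \<longlonglongrightarrow> 0"
    proof (intro AE_I2 tendsto_eventually)
      fix t :: real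
      obtain N :: nat where "t < real N" using reals_Archimedean2 by blast
      then show "\<forall>\<^sub>F n in sequentially. indicator {real n..real n + 1} t *\<^sub>R ?g t = 0"
        by (intro eventually_mono[OF eventually_ge_at_top[of N]]) (auto simp: indicator_def)
    qed
  qed (use gi int in \<open>auto simp: indicator_def\<close>)
  then have "(\<lambda>n. LINT t:{real n..real n + 1}|lborel. ?g t) \<longlonglongrightarrow> 0"
    by (simp add: set_lebesgue_integral_def)
  then show ?thesis
    by (rule Lim_null_comparison[rotated]) (use abs_value_le_average[OF assms] in auto)
qed

lemma powr_kernel_integrable:
  assumes "0 < (\<beta> :: real)"
  shows "set_integrable lborel {0..1} (\<lambda>t. t powr (\<beta> - 1))"
    and "(LINT t:{0..1}|lborel. t powr (\<beta> - 1)) = 1 / \<beta>"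
proof -
  have hi: "((\<lambda>t. t powr (\<beta> - 1)) has_integral 1 / \<beta>) {0..1}"
    using has_integral_powr_from_0[of "\<beta> - 1" 1] assms by simp
  have "(\<lambda>t. t powr (\<beta> - 1)) absolutely_integrable_on {0..1}"
    using hi by (intro nonnegative_absolutely_integrable_1) auto
  then show *: "set_integrable lborel {0..1} (\<lambda>t. t powr (\<beta> - 1))"
    unfolding set_integrable_def by (rule integrable_completion[THEN iffD1, rotated]) measurable
  show "(LINT t:{0..1}|lborel. t powr (\<beta> - 1)) = 1 / \<beta>"
    using set_borel_integral_eq_integral(2)[OF *] hi by (simp add: integral_unique)
qed

text \<open>A bounded integrable function can be integrated against the kernel, which is singular at 0 and bounded away from it. The
  estimate is invariant under translations of \<open>g\<close>, hence all later bounds are uniform in \<open>x\<close>.\<close>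

lemma kernel_product_integrable:
  fixes g :: "real \<Rightarrow> real"
  assumes \<beta>: "0 < \<beta>" "\<beta> < 1" and g: "integrable lborel g" and M: "\<And>t. \<bar>g t\<bar> \<le> M"
  shows "set_integrable lborel {0..} (\<lambda>t. g t * t powr (\<beta> - 1))"
    and "(LINT t:{0..}|lborel. \<bar>g t\<bar> * t powr (\<beta> - 1)) \<le> M / \<beta> + (LINT t|lborel. \<bar>g t\<bar>)"
proof -
  have M0: "M \<ge> 0" using M[of 0] by linarith
  have [measurable]: "g \<in> borel_measurable borel" using g by auto
  (* The bound on g controls the singularity at 0, the integrability of g the rest of the half-line. *)
  define d where "d = (\<lambda>t. M * (indicator {0..1} t *\<^sub>R (t powr (\<beta> - 1))) + \<bar>g t\<bar>)"
  have di: "integrable lborel d"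
    unfolding d_def using powr_kernel_integrable(1)[OF \<beta>(1)] g by (auto simp: set_integrable_def)
  have bound: "indicator {0..} t * (\<bar>g t\<bar> * t powr (\<beta> - 1)) \<le> d t" for t
  proof (cases "t \<in> {0..1}")
    case True
    have "\<bar>g t\<bar> * t powr (\<beta> - 1) \<le> M * t powr (\<beta> - 1)" using M by (intro mult_right_mono) auto
    then show ?thesis using True by (simp add: d_def)
  next
    case False
    show ?thesis
    proof (cases "t < 0")
      case True
      then show ?thesis using M0 by (simp add: d_def)
    next
      case False
      with \<open>t \<notin> {0..1}\<close> have "t > 1" by simp
      then have "t powr (\<beta> - 1) \<le> 1 powr (\<beta> - 1)" using \<beta> by (intro powr_mono2') auto
      then have "\<bar>g t\<bar> * t powr (\<beta> - 1) \<le> \<bar>g t\<bar> * 1" by (intro mult_left_mono) auto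
      then show ?thesis using \<open>t > 1\<close> by (simp add: d_def)
    qed
  qed
  have 1: "set_integrable lborel {0..} (\<lambda>t. \<bar>g t\<bar> * t powr (\<beta> - 1))"
    unfolding set_integrable_def
  proof (rule Bochner_Integration.integrable_bound[OF di])
    show "AE t in lborel. norm (indicator {0..} t *\<^sub>R (\<bar>g t\<bar> * t powr (\<beta> - 1))) \<le> norm (d t)"
    proof (intro AE_I2)
      fix t
      have "norm (indicator {0..} t *\<^sub>R (\<bar>g t\<bar> * t powr (\<beta> - 1))) = indicator {0..} t * (\<bar>g t\<bar> * t powr (\<beta> - 1))"
        by (simp add: abs_mult)
      then show "norm (indicator {0..} t *\<^sub>R (\<bar>g t\<bar> * t powr (\<beta> - 1))) \<le> norm (d t)"
        using bound[of t] by simp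
    qed
  qed measurable
  show "set_integrable lborel {0..} (\<lambda>t. g t * t powr (\<beta> - 1))"
    using 1 unfolding set_integrable_def
    by (rule Bochner_Integration.integrable_bound) (measurable, auto simp: abs_mult)
  have "(LINT t:{0..}|lborel. \<bar>g t\<bar> * t powr (\<beta> - 1)) \<le> (LINT t|lborel. d t)"
    unfolding set_lebesgue_integral_def
    using 1 di bound by (intro integral_mono) (auto simp: set_integrable_def)
  also have "\<dots> = M / \<beta> + (LINT t|lborel. \<bar>g t\<bar>)"
    unfolding d_def using powr_kernel_integrable[OF \<beta>(1)] g
    by (subst Bochner_Integration.integral_add) (auto simp: set_integrable_def set_lebesgue_integral_def)
  finally show "(LINT t:{0..}|lborel. \<bar>g t\<bar> * t powr (\<beta> - 1)) \<le> M / \<beta> + (LINT t|lborel. \<bar>g t\<bar>)" .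
qed

section \<open>The Grunwald sum with unit step\<close>

text \<open>The part of the boundary terms of the integrations by parts that is continuous across the nodes, so that it telescopes.\<close>

definition cell_boundary :: "real \<Rightarrow> (nat \<Rightarrow> real \<Rightarrow> real) \<Rightarrow> nat \<Rightarrow> real" where
  "cell_boundary \<beta> v n = v 2 n * (real n powr \<beta> / Gamma (\<beta> + 1) - spline_B \<beta> n) - v 3 n * kernel_error \<beta> n 0
     + v 1 n * spline_A \<beta> n"

lemma cell_boundary_0: "cell_boundary \<beta> v 0 = 0"
  by (simp add: cell_boundary_def kernel_error_def)

lemma kernel_error_Suc: "kernel_error \<beta> n 1 = kernel_error \<beta> (Suc n) 0"
  by (simp add: kernel_error_def spline_Suc add.commute)

text \<open>On one cell the step function is constant and its primitives are polynomials. Repeated integration by parts moves the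
  derivatives from the kernels to \<open>v\<close>: the exact kernel is left with \<open>v''\<close> and \<open>v'''\<close>, the difference of the kernels with
  \<open>v''''\<close>, and the jumps of the step function leave values of \<open>v\<close> itself.\<close>

lemma cell_has_integral:
  fixes v :: "nat \<Rightarrow> real \<Rightarrow> real"
  assumes \<beta>: "0 < \<beta>" "\<beta> < 1"
    and der: "\<And>i t. i < 4 \<Longrightarrow> (v i has_real_derivative v (Suc i) t) (at t)"
  shows "((\<lambda>t. (v 2 t + (2 - \<beta>) / 2 * v 3 t) * t powr (\<beta> - 1) / Gamma \<beta> - v 4 t * kernel_error \<beta> n (t - n))
           has_integral (cell_boundary \<beta> v (Suc n) - cell_boundary \<beta> v n - spline_D \<beta> n * (v 0 (Suc n) - v 0 n)))
         {real n..real (Suc n)}"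
proof -
  let ?A = "spline_A \<beta> n" and ?B = "spline_B \<beta> n" and ?C = "spline_C \<beta> n" and ?D = "spline_D \<beta> n"
  (* The antiderivative that integration by parts produces: v i is paired with the
     i-th primitive of the step function, for i = 2 and i = 3 together with the powers that it approximates. *)
  define H where "H = (\<lambda>t. v 2 t * (t powr \<beta> / Gamma (\<beta> + 1) - (?B + ?A * (t - n) + ?D * (t - n)\<^sup>2 / 2))
      - v 3 t * kernel_error \<beta> n (t - n) + v 1 t * (?A + ?D * (t - n)) - v 0 t * ?D)"
  have der': "(v 0 has_real_derivative v 1 t) (at t)" "(v 1 has_real_derivative v 2 t) (at t)"
     "(v 2 has_real_derivative v 3 t) (at t)" "(v 3 has_real_derivative v 4 t) (at t)" for t
    using der[of 0 t] der[of 1 t] der[of 2 t] der[of 3 t] by (simp_all add: eval_nat_numeral)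
  have ke: "kernel_error \<beta> n (t - n) = t powr (\<beta> + 1) / Gamma (\<beta> + 2) - (2 - \<beta>) / 2 * t powr \<beta> / Gamma (\<beta> + 1)
     - (?C + ?B * (t - n) + ?A * (t - n)\<^sup>2 / 2 + ?D * (t - n) ^ 3 / 6)" for t :: real
    by (simp add: kernel_error_def)
  have "Gamma \<beta> > 0" using \<beta> by (auto intro: Gamma_real_pos)
  then have G: "Gamma \<beta> \<noteq> 0" by linarith
  have int: "((\<lambda>t. (v 2 t + (2 - \<beta>) / 2 * v 3 t) * t powr (\<beta> - 1) / Gamma \<beta> - v 4 t * kernel_error \<beta> n (t - n))
           has_integral (H (real (Suc n)) - H (real n))) {real n..real (Suc n)}"
  proof (rule fundamental_theorem_of_calculus_interior)
    have "continuous_on {real n..real (Suc n)} (v i)" if "i < 4" for i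
      by (rule DERIV_continuous_on, rule has_field_derivative_at_within, rule der[OF that])
    then have cont: "continuous_on {real n..real (Suc n)} (v 0)" "continuous_on {real n..real (Suc n)} (v 1)"
        "continuous_on {real n..real (Suc n)} (v 2)" "continuous_on {real n..real (Suc n)} (v 3)" by auto
    have pw: "continuous_on {real n..real (Suc n)} (\<lambda>t. t powr p)" if "p > 0" for p
      using that by (intro continuous_on_powr' continuous_intros) auto
    show "continuous_on {real n..real (Suc n)} H"
    proof -
      have Gn: "Gamma (\<beta> + 1) \<noteq> 0" "Gamma (\<beta> + 2) \<noteq> 0" using G \<beta> by (simp_all add: Gamma_plus_12)
      have p: "\<beta> > 0" "\<beta> + 1 > 0" using \<beta> by auto
      show ?thesis
        unfolding H_def ke
        by (intro continuous_on_diff continuous_on_add continuous_on_divide continuous_on_mult continuous_on_const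
            continuous_on_id continuous_on_power cont pw[OF p(1)] pw[OF p(2)]) (simp_all add: Gn)
    qed
  next
    fix t assume "t \<in> {real n<..<real (Suc n)}"
    then have t: "t > 0" by (metis greaterThanLessThan_iff le_less_trans of_nat_0_le_iff)
    have pd: "((\<lambda>t. t powr p) has_real_derivative p * t powr (p - 1)) (at t)" for p
      using t by (auto intro!: derivative_eq_intros)
    have d1: "((\<lambda>t. t powr \<beta> / Gamma (\<beta> + 1)) has_real_derivative t powr (\<beta> - 1) / Gamma \<beta>) (at t)"
      using DERIV_cdivide[OF pd[of \<beta>], of "Gamma (\<beta> + 1)"] \<beta> G by (simp add: Gamma_plus_12)
    have d2: "((\<lambda>t. t powr (\<beta> + 1) / Gamma (\<beta> + 2)) has_real_derivative t powr \<beta> / Gamma (\<beta> + 1)) (at t)"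
      using DERIV_cdivide[OF pd[of "\<beta> + 1"], of "Gamma (\<beta> + 2)"] \<beta> G by (simp add: Gamma_plus_12 mult_ac)
    have k: "((\<lambda>t. kernel_error \<beta> n (t - n)) has_real_derivative
        t powr \<beta> / Gamma (\<beta> + 1) - (2 - \<beta>) / 2 * (t powr (\<beta> - 1) / Gamma \<beta>) - (?B + ?A * (t - n) + ?D * (t - n)\<^sup>2 / 2)) (at t)"
    proof -
      have "((\<lambda>t. ?C + ?B * (t - n) + ?A * (t - n)\<^sup>2 / 2 + ?D * (t - n) ^ 3 / 6)
          has_real_derivative (?B + ?A * (t - n) + ?D * (t - n)\<^sup>2 / 2)) (at t)"
        by (auto intro!: derivative_eq_intros simp: power2_eq_square)
      from DERIV_diff[OF DERIV_diff[OF d2 DERIV_cmult[OF d1, of "(2 - \<beta>) / 2"]] this]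
      show ?thesis unfolding ke by simp
    qed
    have k1: "((\<lambda>t. t powr \<beta> / Gamma (\<beta> + 1) - (?B + ?A * (t - n) + ?D * (t - n)\<^sup>2 / 2))
        has_real_derivative t powr (\<beta> - 1) / Gamma \<beta> - (?A + ?D * (t - n))) (at t)"
      by (intro DERIV_diff[OF d1]) (auto intro!: derivative_eq_intros)
    have k2: "((\<lambda>t. ?A + ?D * (t - n)) has_real_derivative ?D) (at t)"
      by (auto intro!: derivative_eq_intros)
    have "(H has_real_derivative
        (v 2 t + (2 - \<beta>) / 2 * v 3 t) * t powr (\<beta> - 1) / Gamma \<beta> - v 4 t * kernel_error \<beta> n (t - n)) (at t)"
      unfolding H_def
      by (rule DERIV_cong[OF DERIV_diff[OF DERIV_add[OF DERIV_diff[OF DERIV_mult[OF der'(3) k1] DERIV_mult[OF der'(4) k]]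
            DERIV_mult[OF der'(2) k2]] DERIV_mult[OF der'(1) DERIV_const]]])
        (simp add: algebra_simps add_divide_distrib diff_divide_distrib)
    then show "(H has_vector_derivative
        (v 2 t + (2 - \<beta>) / 2 * v 3 t) * t powr (\<beta> - 1) / Gamma \<beta> - v 4 t * kernel_error \<beta> n (t - n)) (at t)"
      by (simp add: has_real_derivative_iff_has_vector_derivative)
  qed simp
  have "H (real n) = cell_boundary \<beta> v n - v 0 n * ?D"
    by (simp add: H_def cell_boundary_def)
  moreover have "H (real (Suc n)) = cell_boundary \<beta> v (Suc n) - v 0 (Suc n) * ?D"
    using kernel_error_Suc[of \<beta> n] by (simp add: H_def cell_boundary_def spline_Suc)
  ultimately have "H (real (Suc n)) - H (real n)
      = cell_boundary \<beta> v (Suc n) - cell_boundary \<beta> v n - ?D * (v 0 (Suc n) - v 0 n)"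
    by (simp only: algebra_simps)
  with int show ?thesis by (simp only:)
qed

text \<open>Turns the increments of \<open>w\<close> left over by the cells into the Grunwald sum.\<close>

lemma summation_by_parts:
  "(\<Sum>n<N. spline_D \<beta> n * (w (Suc n) - w n)) = spline_D \<beta> N * w N - (\<Sum>l\<le>N. rising (\<beta> - 2) l * w l)"
proof (induction N)
  case (Suc N)
  have "spline_D \<beta> (Suc N) = spline_D \<beta> N + rising (\<beta> - 2) (Suc N)"
    using rising_diff[of "\<beta> - 1" N] by (simp add: spline_D_def)
  with Suc show ?case by (simp add: algebra_simps)
qed simp

text \<open>The sum of the cell identities for the first \<open>N\<close> cells, with the kernel error replaced by its bound.\<close>

lemma partial_grunwald_bound:
  fixes v :: "nat \<Rightarrow> real \<Rightarrow> real"
  assumes \<beta>: "0 < \<beta>" "\<beta> < 1" and K: "K \<ge> 0"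
    "\<And>n \<tau>. 0 \<le> \<tau> \<Longrightarrow> \<tau> \<le> 1 \<Longrightarrow> real n + \<tau> > 0 \<Longrightarrow> \<bar>kernel_error \<beta> n \<tau>\<bar> \<le> K * (n + \<tau>) powr (\<beta> - 1)"
    and der: "\<And>i t. i < 4 \<Longrightarrow> (v i has_real_derivative v (Suc i) t) (at t)"
    and int1: "set_integrable lborel {0..} (\<lambda>t. (v 2 t + (2 - \<beta>) / 2 * v 3 t) * t powr (\<beta> - 1))"
    and int2: "set_integrable lborel {0..} (\<lambda>t. \<bar>v 4 t\<bar> * t powr (\<beta> - 1))"
  shows "\<bar>(LINT t:{0..real N}|lborel. (v 2 t + (2 - \<beta>) / 2 * v 3 t) * t powr (\<beta> - 1)) / Gamma \<beta>
      - ((\<Sum>l\<le>N. rising (\<beta> - 2) l * v 0 l) + cell_boundary \<beta> v N - spline_D \<beta> N * v 0 N)\<bar>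
      \<le> K * (LINT t:{0..real N}|lborel. \<bar>v 4 t\<bar> * t powr (\<beta> - 1))"
proof -
  define \<phi> where "\<phi> = (\<lambda>t. (v 2 t + (2 - \<beta>) / 2 * v 3 t) * t powr (\<beta> - 1) / Gamma \<beta>)"
  define \<psi> where "\<psi> = (\<lambda>t. \<bar>v 4 t\<bar> * t powr (\<beta> - 1))"
  have sub: "\<phi> integrable_on {a..b}" "\<psi> integrable_on {a..b}" if "0 \<le> a" for a b
  proof -
    have "set_integrable lborel {a..b} \<phi>"
      unfolding \<phi>_def using set_integrable_subset[OF int1, of "{a..b}"] that by (auto intro!: set_integrable_divide)
    then show "\<phi> integrable_on {a..b}" by (rule set_borel_integral_eq_integral(1))
    have "set_integrable lborel {a..b} \<psi>"
      unfolding \<psi>_def using set_integrable_subset[OF int2, of "{a..b}"] that by auto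
    then show "\<psi> integrable_on {a..b}" by (rule set_borel_integral_eq_integral(1))
  qed
  have cell: "\<bar>integral {real n..real (Suc n)} \<phi>
      - (cell_boundary \<beta> v (Suc n) - cell_boundary \<beta> v n - spline_D \<beta> n * (v 0 (Suc n) - v 0 n))\<bar>
      \<le> K * integral {real n..real (Suc n)} \<psi>" for n
  proof -
    let ?I = "{real n..real (Suc n)}" and ?x = "cell_boundary \<beta> v (Suc n) - cell_boundary \<beta> v n - spline_D \<beta> n * (v 0 (Suc n) - v 0 n)"
    let ?e = "\<lambda>t. v 4 t * kernel_error \<beta> n (t - n)"
    have "((\<lambda>t. \<phi> t - ?e t) has_integral ?x) ?I"
      unfolding \<phi>_def by (rule cell_has_integral[where v = v, OF \<beta> der])
    moreover have "(\<phi> has_integral integral ?I \<phi>) ?I"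
      by (intro integrable_integral sub) simp
    ultimately have "((\<lambda>t. \<phi> t - (\<phi> t - ?e t)) has_integral (integral ?I \<phi> - ?x)) ?I"
      by (rule has_integral_diff[rotated])
    then have e: "(?e has_integral (integral ?I \<phi> - ?x)) ?I" by simp
    have "norm (integral ?I ?e) \<le> integral ?I (\<lambda>t. K * \<psi> t)"
    proof (rule integral_norm_bound_integral)
      show "?e integrable_on ?I" using e by blast
      show "(\<lambda>t. K * \<psi> t) integrable_on ?I" using integrable_cmul[OF sub(2)[of n "Suc n"], of K] by simp
      fix t assume t: "t \<in> ?I"
      show "norm (?e t) \<le> K * \<psi> t"
      (* At t = 0 the bound on the kernel error is not available, but there both sides vanish. *)
      proof (cases "t = 0")
        case True
        then have "n = 0" using t by simp
        then show ?thesis using True by (simp add: kernel_error_def \<psi>_def)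
      next
        case False
        then have "t > 0" using t by (metis atLeastAtMost_iff of_nat_0_le_iff order_le_less order_trans)
        then have "\<bar>kernel_error \<beta> n (t - n)\<bar> \<le> K * t powr (\<beta> - 1)"
          using K(2)[of "t - n" n] t by simp
        then have "\<bar>v 4 t\<bar> * \<bar>kernel_error \<beta> n (t - n)\<bar> \<le> \<bar>v 4 t\<bar> * (K * t powr (\<beta> - 1))"
          by (rule mult_left_mono) simp
        then show ?thesis by (simp add: \<psi>_def abs_mult mult_ac)
      qed
    qed
    then show ?thesis using integral_unique[OF e] by simp
  qed
  have "\<bar>integral {0..real N} \<phi> - (cell_boundary \<beta> v N - (\<Sum>n<N. spline_D \<beta> n * (v 0 (Suc n) - v 0 n)))\<bar>
      \<le> K * integral {0..real N} \<psi>"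
  proof (induction N)
    case 0
    then show ?case by (simp add: cell_boundary_0)
  next
    case (Suc N)
    have "integral {0..real (Suc N)} \<phi> = integral {0..real N} \<phi> + integral {real N..real (Suc N)} \<phi>"
      using sub by (intro Henstock_Kurzweil_Integration.integral_combine[symmetric]) auto
    moreover have "integral {0..real (Suc N)} \<psi> = integral {0..real N} \<psi> + integral {real N..real (Suc N)} \<psi>"
      using sub by (intro Henstock_Kurzweil_Integration.integral_combine[symmetric]) auto
    ultimately show ?case using Suc cell[of N] by (simp add: distrib_left)
  qed
  moreover have "(LINT t:{0..real N}|lborel. (v 2 t + (2 - \<beta>) / 2 * v 3 t) * t powr (\<beta> - 1)) / Gamma \<beta> = integral {0..real N} \<phi>"
    using set_borel_integral_eq_integral(2)[OF set_integrable_subset[OF int1, of "{0..real N}"]]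
    by (simp add: \<phi>_def)
  moreover have "(LINT t:{0..real N}|lborel. \<bar>v 4 t\<bar> * t powr (\<beta> - 1)) = integral {0..real N} \<psi>"
    using set_borel_integral_eq_integral(2)[OF set_integrable_subset[OF int2, of "{0..real N}"]]
    by (simp add: \<psi>_def)
  ultimately show ?thesis
    by (simp add: summation_by_parts[of \<beta> "\<lambda>n. v 0 (real n)", simplified])
qed

text \<open>The factors of the values of \<open>v\<close> and its derivatives are bounded and these values tend to 0.\<close>

lemma cell_boundary_tendsto_0:
  assumes \<beta>: "0 < \<beta>" "\<beta> < 1"
    and v: "\<And>i. i < 4 \<Longrightarrow> (\<lambda>n. v i (real n)) \<longlonglongrightarrow> 0"
  shows "(\<lambda>n. cell_boundary \<beta> v n - spline_D \<beta> n * v 0 (real n)) \<longlonglongrightarrow> 0"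
proof -
  obtain M where M: "\<And>n. \<bar>real n powr \<beta> / Gamma (\<beta> + 1) - spline_B \<beta> n\<bar> \<le> M"
    using spline_B_error_bounded[OF \<beta>] by blast
  obtain K where K: "K \<ge> 0" "\<And>n \<tau>. 0 \<le> \<tau> \<Longrightarrow> \<tau> \<le> 1 \<Longrightarrow> real n + \<tau> > 0 \<Longrightarrow> \<bar>kernel_error \<beta> n \<tau>\<bar> \<le> K * (n + \<tau>) powr (\<beta> - 1)"
    using kernel_error_bound[OF \<beta>] by blast
  have Q: "\<bar>kernel_error \<beta> n 0\<bar> \<le> K" for n
  proof (cases "n = 0")
    case True
    then show ?thesis using K(1) by (simp add: kernel_error_def)
  next
    case False
    then have "\<bar>kernel_error \<beta> n 0\<bar> \<le> K * real n powr (\<beta> - 1)" using K(2)[of 0 n] by simp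
    also have "\<dots> \<le> K * 1 powr (\<beta> - 1)"
      using K(1) False \<beta> by (intro mult_left_mono powr_mono2') auto
    finally show ?thesis by simp
  qed
  have D: "\<bar>spline_D \<beta> n\<bar> \<le> 1" "\<bar>spline_A \<beta> n\<bar> \<le> 2" for n
    unfolding spline_D_def spline_A_def
    using abs_rising_le_1[of \<beta> n] abs_rising_le_1[of "\<beta> - 1" n] \<beta> by auto
  have bd: "(\<lambda>n. a n * b n) \<longlonglongrightarrow> 0" if "a \<longlonglongrightarrow> 0" "\<And>n. \<bar>b n\<bar> \<le> c" for a b :: "nat \<Rightarrow> real" and c
  proof (rule Lim_null_comparison)
    show "\<forall>\<^sub>F n in sequentially. norm (a n * b n) \<le> \<bar>a n\<bar> * c"
      using that(2) by (auto simp: abs_mult intro!: always_eventually mult_left_mono)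
    show "(\<lambda>n. \<bar>a n\<bar> * c) \<longlonglongrightarrow> 0"
      by (intro tendsto_mult_left_zero tendsto_rabs_zero that(1))
  qed
  have "(\<lambda>n. v 2 (real n) * (real n powr \<beta> / Gamma (\<beta> + 1) - spline_B \<beta> n) - v 3 (real n) * kernel_error \<beta> n 0
     + v 1 (real n) * spline_A \<beta> n - v 0 (real n) * spline_D \<beta> n) \<longlonglongrightarrow> 0 - 0 + 0 - 0"
    by (intro tendsto_diff tendsto_add bd[OF v M] bd[OF v Q] bd[OF v D(2)] bd[OF v D(1)]) auto
  then show ?thesis by (simp add: cell_boundary_def mult.commute)
qed

text \<open>The Grunwald sum with step 1 equals the Weyl integral of \<open>v''\<close>, corrected by \<open>\<alpha> / 2\<close> times that of \<open>v'''\<close>, up to a Weyl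
  integral of the modulus of \<open>v''''\<close>. The sign of the correction is positive because \<open>v\<close> runs away from the
  evaluation point. The constant \<open>K\<close> does not depend on \<open>v\<close>, which allows rescaling.\<close>

lemma grunwald_unit_step:
  fixes v :: "nat \<Rightarrow> real \<Rightarrow> real"
  assumes \<beta>: "0 < \<beta>" "\<beta> < 1" and K: "K \<ge> 0"
    "\<And>n \<tau>. 0 \<le> \<tau> \<Longrightarrow> \<tau> \<le> 1 \<Longrightarrow> real n + \<tau> > 0 \<Longrightarrow> \<bar>kernel_error \<beta> n \<tau>\<bar> \<le> K * (n + \<tau>) powr (\<beta> - 1)"
    and der: "\<And>i t. i < 4 \<Longrightarrow> (v i has_real_derivative v (Suc i) t) (at t)"
    and int: "\<And>i. i \<le> 4 \<Longrightarrow> integrable lborel (v i)"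
    and bnd: "\<And>t. \<bar>v 4 t\<bar> \<le> M"
    and sum: "summable (\<lambda>l. rising (\<beta> - 2) l * v 0 (real l))"
  shows "\<bar>(LINT t:{0..}|lborel. (v 2 t + (2 - \<beta>) / 2 * v 3 t) * t powr (\<beta> - 1)) / Gamma \<beta>
      - (\<Sum>l. rising (\<beta> - 2) l * v 0 (real l))\<bar> \<le> K * (LINT t:{0..}|lborel. \<bar>v 4 t\<bar> * t powr (\<beta> - 1))"
proof -
  have vb: "\<exists>M. \<forall>t. \<bar>v i t\<bar> \<le> M" if "i < 4" for i
    using abs_value_le_L1_norms[OF der[OF that]] int[of i] int[of "Suc i"] that by auto
  have int1: "set_integrable lborel {0..} (\<lambda>t. (v 2 t + (2 - \<beta>) / 2 * v 3 t) * t powr (\<beta> - 1))"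
  proof -
    obtain M2 M3 where "\<And>t. \<bar>v 2 t\<bar> \<le> M2" "\<And>t. \<bar>v 3 t\<bar> \<le> M3" using vb[of 2] vb[of 3] by auto
    then have "set_integrable lborel {0..} (\<lambda>t. v 2 t * t powr (\<beta> - 1) + (2 - \<beta>) / 2 * (v 3 t * t powr (\<beta> - 1)))"
      using int by (intro set_integral_add set_integrable_mult_right kernel_product_integrable(1)[OF \<beta>]) auto
    then show ?thesis by (simp add: algebra_simps)
  qed
  have int2: "set_integrable lborel {0..} (\<lambda>t. \<bar>v 4 t\<bar> * t powr (\<beta> - 1))"
    using int[of 4] bnd by (intro kernel_product_integrable(1)[OF \<beta>]) auto
  have lim: "(\<lambda>N. LINT t:{0..real N}|lborel. f t) \<longlonglongrightarrow> (LINT t:{0..}|lborel. f t)"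
    if "set_integrable lborel {0..} f" for f :: "real \<Rightarrow> real"
  proof -
    have "((\<lambda>b. LINT t:{0..b}|lborel. f t) \<longlongrightarrow> (LINT t:{0..}|lborel. f t)) at_top"
      using that by (intro tendsto_set_lebesgue_integral_at_top) auto
    then show ?thesis using filterlim_real_sequentially by (rule filterlim_compose)
  qed
  have v0: "(\<lambda>n. v i (real n)) \<longlonglongrightarrow> 0" if "i < 4" for i
    using vanishes_at_infinity[OF der[OF that]] int[of i] int[of "Suc i"] that by auto
  have "Gamma \<beta> > 0" using \<beta> by (auto intro: Gamma_real_pos)
  then have G: "Gamma \<beta> \<noteq> 0" by linarith
  have "(\<lambda>N. \<bar>(LINT t:{0..real N}|lborel. (v 2 t + (2 - \<beta>) / 2 * v 3 t) * t powr (\<beta> - 1)) / Gamma \<beta>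
      - ((\<Sum>l\<le>N. rising (\<beta> - 2) l * v 0 (real l)) + (cell_boundary \<beta> v N - spline_D \<beta> N * v 0 (real N)))\<bar>)
    \<longlonglongrightarrow> \<bar>(LINT t:{0..}|lborel. (v 2 t + (2 - \<beta>) / 2 * v 3 t) * t powr (\<beta> - 1)) / Gamma \<beta>
      - ((\<Sum>l. rising (\<beta> - 2) l * v 0 (real l)) + 0)\<bar>"
    using G by (intro tendsto_intros lim int1 cell_boundary_tendsto_0[OF \<beta> v0] summable_LIMSEQ' sum)
  moreover have "(\<lambda>N. K * (LINT t:{0..real N}|lborel. \<bar>v 4 t\<bar> * t powr (\<beta> - 1)))
      \<longlonglongrightarrow> K * (LINT t:{0..}|lborel. \<bar>v 4 t\<bar> * t powr (\<beta> - 1))"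
    by (intro tendsto_intros lim int2)
  ultimately show ?thesis
    using partial_grunwald_bound[OF \<beta> K der int1 int2]
    by (intro LIMSEQ_le[rotated 2, of _ _ _ ]) (auto simp: add_diff_eq)
qed

section \<open>Weyl integrals and their Taylor expansion\<close>

text \<open>The Liouville fractional integral of order \<open>\<beta>\<close> without the factor \<open>1 / Gamma \<beta>\<close>, in convolution form, so that
  \<open>x\<close> occurs only in the argument of \<open>g\<close>.\<close>

definition weyl_integral :: "real \<Rightarrow> (real \<Rightarrow> real) \<Rightarrow> real \<Rightarrow> real" where
  "weyl_integral \<beta> g x = (LINT t:{0..}|lborel. g (x - t) * t powr (\<beta> - 1))"

lemma integrable_reflect:
  fixes g :: "real \<Rightarrow> real"
  assumes "integrable lborel g"
  shows "integrable lborel (\<lambda>t. g (x - t))" "(LINT t|lborel. g (x - t)) = (LINT t|lborel. g t)"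
  using lborel_integrable_real_affine[OF assms, of "-1" x] lborel_integral_real_affine[of "-1" g x] by auto

lemma weyl_integrable:
  fixes g :: "real \<Rightarrow> real"
  assumes "0 < \<beta>" "\<beta> < 1" "integrable lborel g" "\<And>t. \<bar>g t\<bar> \<le> M"
  shows "set_integrable lborel {0..} (\<lambda>t. g (x - t) * t powr (\<beta> - 1))"
  by (rule kernel_product_integrable(1)[OF assms(1,2) integrable_reflect(1)[OF assms(3)]]) (rule assms(4))

lemma weyl_integral_abs_le:
  fixes g :: "real \<Rightarrow> real"
  assumes "0 < \<beta>" "\<beta> < 1" "integrable lborel g" "\<And>t. \<bar>g t\<bar> \<le> M"
  shows "weyl_integral \<beta> (\<lambda>t. \<bar>g t\<bar>) x \<le> M / \<beta> + (LINT t|lborel. \<bar>g t\<bar>)"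
  unfolding weyl_integral_def
  using kernel_product_integrable(2)[OF assms(1,2) integrable_reflect(1)[OF assms(3)], of x M]
    integrable_reflect(2)[of "\<lambda>t. \<bar>g t\<bar>" x] assms(3,4) by simp

lemma weyl_integral_scale:
  assumes h: "h > 0"
  shows "(LINT t:{0..}|lborel. g (x - h * t) * t powr (\<beta> - 1)) = h powr (- \<beta>) * weyl_integral \<beta> g x"
proof -
  have "weyl_integral \<beta> g x = h * (LINT t|lborel. indicator {0..} (h * t) *\<^sub>R (g (x - h * t) * (h * t) powr (\<beta> - 1)))"
    unfolding weyl_integral_def set_lebesgue_integral_def
    using h by (subst lborel_integral_real_affine[of h _ 0]) auto
  also have "(\<lambda>t. indicator {0..} (h * t) *\<^sub>R (g (x - h * t) * (h * t) powr (\<beta> - 1)))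
      = (\<lambda>t. h powr (\<beta> - 1) * (indicator {0..} t *\<^sub>R (g (x - h * t) * t powr (\<beta> - 1))))"
    using h by (auto simp: fun_eq_iff indicator_def powr_mult zero_le_mult_iff)
  also have "(LINT t|lborel. h powr (\<beta> - 1) * (indicator {0..} t *\<^sub>R (g (x - h * t) * t powr (\<beta> - 1))))
      = h powr (\<beta> - 1) * (LINT t:{0..}|lborel. g (x - h * t) * t powr (\<beta> - 1))"
    by (simp add: set_lebesgue_integral_def)
  finally show ?thesis using h by (simp add: powr_minus powr_diff)
qed

text \<open>The substitution \<open>s = x - t\<close>.\<close>

lemma liouville_integral_eq_weyl:
  assumes \<alpha>: "1 < \<alpha>" "\<alpha> < 2" and u: "integrable lborel u" "\<And>t. \<bar>u t\<bar> \<le> M"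
  shows "liouville_integral \<alpha> u x = weyl_integral (2 - \<alpha>) u x"
    and "set_integrable lborel {..<x} (\<lambda>s. u s / (x - s) powr (\<alpha> - 1))"
proof -
  let ?f = "\<lambda>s. indicator {..<x} s *\<^sub>R (u s / (x - s) powr (\<alpha> - 1))"
  have eq: "(\<lambda>t. ?f (x + (-1) * t)) = (\<lambda>t. indicator {0..} t *\<^sub>R (u (x - t) * t powr ((2 - \<alpha>) - 1)))"
  proof
    fix t :: real
    show "?f (x + (-1) * t) = indicator {0..} t *\<^sub>R (u (x - t) * t powr ((2 - \<alpha>) - 1))"
    proof (cases "t > 0")
      case True
      have "t powr ((2 - \<alpha>) - 1) = t powr (- (\<alpha> - 1))" by (simp add: algebra_simps)
      then show ?thesis using True by (simp only: powr_minus) (simp add: indicator_def divide_inverse)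
    next
      case False
      then show ?thesis by (cases "t = 0") (auto simp: indicator_def)
    qed
  qed
  have "set_integrable lborel {0..} (\<lambda>t. u (x - t) * t powr ((2 - \<alpha>) - 1))"
    using \<alpha> u by (intro weyl_integrable) auto
  then show "set_integrable lborel {..<x} (\<lambda>s. u s / (x - s) powr (\<alpha> - 1))"
    unfolding set_integrable_def eq[symmetric] by (subst (asm) lborel_integrable_real_affine_iff) auto
  have "(LINT s|lborel. ?f s) = (LINT t|lborel. ?f (x + (-1) * t))"
    using lborel_integral_real_affine[of "-1" ?f x] by simp
  then show "liouville_integral \<alpha> u x = weyl_integral (2 - \<alpha>) u x"
    unfolding liouville_integral_def weyl_integral_def set_lebesgue_integral_def eq by simp
qed

text \<open>The enlarged interval from \<open>a\<close> to \<open>b\<close> contains 0 and \<open>\<xi>\<close> in either order, which covers shifts of both signs.\<close>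

lemma increment_le_nn_integral:
  fixes f f' :: "real \<Rightarrow> real"
  assumes der: "\<And>t. (f has_real_derivative f' t) (at t)" and int: "integrable lborel f'"
    and \<xi>: "a \<le> 0" "0 \<le> b" "a \<le> \<xi>" "\<xi> \<le> b"
  shows "ennreal \<bar>f (z + \<xi>) - f z\<bar> \<le> (\<integral>\<^sup>+r. ennreal (indicator {a..b} r * \<bar>f' (z + r)\<bar>) \<partial>lborel)"
proof -
  have int': "integrable lborel (\<lambda>r. f' (z + r))"
    using lborel_integrable_real_affine[OF int, of 1 z] by simp
  have der': "((\<lambda>r. f (z + r)) has_real_derivative f' (z + t)) (at t)" for t
    using DERIV_shift[of f "f' (z + t)" t z] der[of "t + z"] by (simp add: add.commute)
  have le: "\<bar>f (z + q) - f (z + p)\<bar> \<le> (LINT r|lborel. indicator {a..b} r * \<bar>f' (z + r)\<bar>)"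
    if "a \<le> p" "p \<le> q" "q \<le> b" for p q
  proof -
    have "\<bar>f (z + q) - f (z + p)\<bar> = \<bar>LINT r:{p..q}|lborel. f' (z + r)\<bar>"
      using ftc_lborel[OF der' int' \<open>p \<le> q\<close>] by simp
    also have "\<dots> \<le> (LINT r:{p..q}|lborel. \<bar>f' (z + r)\<bar>)"
      using set_integral_norm_bound[OF set_integrable_subset_lborel[OF int', of "{p..q}"]] by simp
    also have "\<dots> \<le> (LINT r|lborel. indicator {a..b} r * \<bar>f' (z + r)\<bar>)"
      unfolding set_lebesgue_integral_def
      using that int' integrable_mult_indicator[of "{a..b}" lborel "\<lambda>r. \<bar>f' (z + r)\<bar>"]
        integrable_mult_indicator[of "{p..q}" lborel "\<lambda>r. \<bar>f' (z + r)\<bar>"]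
      by (intro integral_mono) (auto simp: indicator_def)
    finally show ?thesis .
  qed
  have "\<bar>f (z + \<xi>) - f z\<bar> \<le> (LINT r|lborel. indicator {a..b} r * \<bar>f' (z + r)\<bar>)"
    using le[of 0 \<xi>] le[of \<xi> 0] \<xi> by (cases "0 \<le> \<xi>") (auto simp: abs_minus_commute)
  moreover have "(\<integral>\<^sup>+r. ennreal (indicator {a..b} r * \<bar>f' (z + r)\<bar>) \<partial>lborel)
      = ennreal (LINT r|lborel. indicator {a..b} r * \<bar>f' (z + r)\<bar>)"
    using int' integrable_mult_indicator[of "{a..b}" lborel "\<lambda>r. \<bar>f' (z + r)\<bar>"]
    by (intro nn_integral_eq_integral) auto
  ultimately show ?thesis by (simp add: ennreal_leI)
qed

text \<open>If a remainder is at each point at most an integral of \<open>\<bar>g\<bar>\<close> over translations, then its Weyl integral is bounded by the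
  Weyl integrals of \<open>\<bar>g\<bar>\<close>, for which there is a uniform bound.\<close>

lemma weyl_remainder_bound:
  fixes g R :: "real \<Rightarrow> real"
  assumes \<beta>: "0 < \<beta>" "\<beta> < 1" and g: "integrable lborel g" "\<And>t. \<bar>g t\<bar> \<le> M"
    and R: "set_integrable lborel {0..} (\<lambda>t. R t * t powr (\<beta> - 1))"
    and c: "c \<ge> 0" and ab: "a \<le> b"
    and le: "\<And>t. ennreal \<bar>R t\<bar> \<le> ennreal c * (\<integral>\<^sup>+r. ennreal (indicator {a..b} r * \<bar>g (x - t + r)\<bar>) \<partial>lborel)"
  shows "\<bar>LINT t:{0..}|lborel. R t * t powr (\<beta> - 1)\<bar> \<le> c * (b - a) * (M / \<beta> + (LINT t|lborel. \<bar>g t\<bar>))"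
proof -
  define C where "C = M / \<beta> + (LINT t|lborel. \<bar>g t\<bar>)"
  have [measurable]: "g \<in> borel_measurable borel" using g(1) by auto
  define k where "k = (\<lambda>t. indicator {0..} t * t powr (\<beta> - 1) :: real)"
  have k [measurable]: "k \<in> borel_measurable borel" unfolding k_def by measurable
  have k0: "k t \<ge> 0" for t by (simp add: k_def)
  have M0: "M \<ge> 0" using g(2)[of 0] by linarith
  have C0: "C \<ge> 0" unfolding C_def using M0 \<beta> by (intro add_nonneg_nonneg) auto
  have inner: "(\<integral>\<^sup>+t. ennreal (k t * \<bar>g (x - t + r)\<bar>) \<partial>lborel) \<le> ennreal C" for r
  proof -
    have int: "set_integrable lborel {0..} (\<lambda>t. \<bar>g ((x + r) - t)\<bar> * t powr (\<beta> - 1))"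
      using \<beta> g by (intro weyl_integrable[where g = "\<lambda>t. \<bar>g t\<bar>"]) auto
    have eq: "k t * \<bar>g (x - t + r)\<bar> = indicator {0..} t *\<^sub>R (\<bar>g ((x + r) - t)\<bar> * t powr (\<beta> - 1))" for t
      by (simp add: k_def algebra_simps)
    have "(\<integral>\<^sup>+t. ennreal (k t * \<bar>g (x - t + r)\<bar>) \<partial>lborel) = ennreal (weyl_integral \<beta> (\<lambda>t. \<bar>g t\<bar>) (x + r))"
      unfolding weyl_integral_def set_lebesgue_integral_def eq
      using int by (intro nn_integral_eq_integral) (auto simp: set_integrable_def)
    also have "\<dots> \<le> ennreal C"
      unfolding C_def by (intro ennreal_leI weyl_integral_abs_le \<beta> g)
    finally show ?thesis .
  qed
  have "ennreal \<bar>LINT t:{0..}|lborel. R t * t powr (\<beta> - 1)\<bar>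
      \<le> (\<integral>\<^sup>+t. ennreal \<bar>indicator {0..} t *\<^sub>R (R t * t powr (\<beta> - 1))\<bar> \<partial>lborel)"
    unfolding set_lebesgue_integral_def
    using integral_norm_bound_ennreal[OF R[unfolded set_integrable_def]] by simp
  also have "\<dots> = (\<integral>\<^sup>+t. ennreal (k t) * ennreal \<bar>R t\<bar> \<partial>lborel)"
    by (intro nn_integral_cong) (simp add: k_def abs_mult mult_ac flip: ennreal_mult)
  also have "\<dots> \<le> (\<integral>\<^sup>+t. ennreal (k t) * (ennreal c * (\<integral>\<^sup>+r. ennreal (indicator {a..b} r * \<bar>g (x - t + r)\<bar>) \<partial>lborel)) \<partial>lborel)"
    by (intro nn_integral_mono mult_left_mono le) auto
  also have "\<dots> = (\<integral>\<^sup>+t. (\<integral>\<^sup>+r. ennreal c * (ennreal (indicator {a..b} r) * ennreal (k t * \<bar>g (x - t + r)\<bar>)) \<partial>lborel) \<partial>lborel)"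
  proof (rule nn_integral_cong)
    fix t
    have "(\<integral>\<^sup>+r. ennreal c * (ennreal (indicator {a..b} r) * ennreal (k t * \<bar>g (x - t + r)\<bar>)) \<partial>lborel)
        = (\<integral>\<^sup>+r. (ennreal (k t) * ennreal c) * ennreal (indicator {a..b} r * \<bar>g (x - t + r)\<bar>) \<partial>lborel)"
      by (intro nn_integral_cong) (simp add: k0 ennreal_mult mult_ac)
    also have "\<dots> = (ennreal (k t) * ennreal c) * (\<integral>\<^sup>+r. ennreal (indicator {a..b} r * \<bar>g (x - t + r)\<bar>) \<partial>lborel)"
      by (rule nn_integral_cmult) measurable
    finally show "ennreal (k t) * (ennreal c * (\<integral>\<^sup>+r. ennreal (indicator {a..b} r * \<bar>g (x - t + r)\<bar>) \<partial>lborel))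
        = (\<integral>\<^sup>+r. ennreal c * (ennreal (indicator {a..b} r) * ennreal (k t * \<bar>g (x - t + r)\<bar>)) \<partial>lborel)"
      by (simp only: mult.assoc)
  qed
  (* Tonelli: for each fixed r the integral over t is a Weyl integral of |g|, at the point x + r. *)
  also have "\<dots> = (\<integral>\<^sup>+r. (\<integral>\<^sup>+t. ennreal c * (ennreal (indicator {a..b} r) * ennreal (k t * \<bar>g (x - t + r)\<bar>)) \<partial>lborel) \<partial>lborel)"
    by (rule lborel_pair.Fubini') measurable
  also have "\<dots> = (\<integral>\<^sup>+r. ennreal c * (ennreal (indicator {a..b} r) * (\<integral>\<^sup>+t. ennreal (k t * \<bar>g (x - t + r)\<bar>) \<partial>lborel)) \<partial>lborel)"
    by (simp add: nn_integral_cmult)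
  also have "\<dots> \<le> (\<integral>\<^sup>+r. ennreal c * (ennreal (indicator {a..b} r) * ennreal C) \<partial>lborel)"
    by (intro nn_integral_mono mult_left_mono inner) auto
  also have "\<dots> = (\<integral>\<^sup>+r. (ennreal c * ennreal C) * indicator {a..b} r \<partial>lborel)"
    by (intro nn_integral_cong) (auto simp: indicator_def)
  also have "\<dots> = ennreal (c * (b - a) * C)"
    using ab c C0 by (subst nn_integral_cmult_indicator) (auto simp: mult_ac simp flip: ennreal_mult)
  finally show ?thesis
    using ab c C0 by (subst (asm) ennreal_le_iff) (auto simp: C_def)
qed

lemma weyl_integral_diff:
  assumes "set_integrable lborel {0..} (\<lambda>t. f t * t powr (\<beta> - 1))" "set_integrable lborel {0..} (\<lambda>t. g t * t powr (\<beta> - 1))"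
  shows "set_integrable lborel {0..} (\<lambda>t. (f t - g t) * t powr (\<beta> - 1))"
   "(LINT t:{0..}|lborel. (f t - g t) * t powr (\<beta> - 1))
      = (LINT t:{0..}|lborel. f t * t powr (\<beta> - 1)) - (LINT t:{0..}|lborel. g t * t powr (\<beta> - 1))"
  unfolding left_diff_distrib using set_integral_diff[OF assms] by auto

lemma weyl_integral_lipschitz:
  fixes f f' :: "real \<Rightarrow> real"
  assumes \<beta>: "0 < \<beta>" "\<beta> < 1"
    and der: "\<And>t. (f has_real_derivative f' t) (at t)"
    and int: "integrable lborel f" "integrable lborel f'"
    and bnd: "\<And>t. \<bar>f t\<bar> \<le> M0" "\<And>t. \<bar>f' t\<bar> \<le> M"
  shows "\<bar>weyl_integral \<beta> f (x + \<delta>) - weyl_integral \<beta> f x\<bar> \<le> \<bar>\<delta>\<bar> * (M / \<beta> + (LINT t|lborel. \<bar>f' t\<bar>))"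
proof -
  note si = weyl_integrable[OF \<beta> int(1) bnd(1)]
  have "\<bar>LINT t:{0..}|lborel. (f (x + \<delta> - t) - f (x - t)) * t powr (\<beta> - 1)\<bar>
      \<le> 1 * (max 0 \<delta> - min 0 \<delta>) * (M / \<beta> + (LINT t|lborel. \<bar>f' t\<bar>))"
  proof (rule weyl_remainder_bound[OF \<beta> int(2) bnd(2)])
    show "set_integrable lborel {0..} (\<lambda>t. (f (x + \<delta> - t) - f (x - t)) * t powr (\<beta> - 1))"
      by (rule weyl_integral_diff(1)[OF si si])
    show "ennreal \<bar>f (x + \<delta> - t) - f (x - t)\<bar>
        \<le> ennreal 1 * (\<integral>\<^sup>+r. ennreal (indicator {min 0 \<delta>..max 0 \<delta>} r * \<bar>f' (x - t + r)\<bar>) \<partial>lborel)" for t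
      using increment_le_nn_integral[OF der int(2), of "min 0 \<delta>" "max 0 \<delta>" \<delta> "x - t"] by (simp add: algebra_simps)
  qed auto
  moreover have "max 0 \<delta> - min 0 \<delta> = \<bar>\<delta>\<bar>" by auto
  ultimately show ?thesis
    unfolding weyl_integral_def weyl_integral_diff(2)[OF si si] by simp
qed

text \<open>The constant 1 instead of 1/2 in front of the remainder comes from estimating the inner integral over the whole range of the
  shift.\<close>

lemma weyl_integral_taylor:
  fixes f f' f'' :: "real \<Rightarrow> real"
  assumes \<beta>: "0 < \<beta>" "\<beta> < 1"
    and der: "\<And>t. (f has_real_derivative f' t) (at t)" "\<And>t. (f' has_real_derivative f'' t) (at t)"
    and int: "integrable lborel f" "integrable lborel f'" "integrable lborel f''"
    and bnd: "\<And>t. \<bar>f t\<bar> \<le> M0" "\<And>t. \<bar>f' t\<bar> \<le> M1" "\<And>t. \<bar>f'' t\<bar> \<le> M"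
  shows "\<bar>weyl_integral \<beta> f (x + \<delta>) - weyl_integral \<beta> f x - \<delta> * weyl_integral \<beta> f' x\<bar>
      \<le> \<delta>\<^sup>2 * (M / \<beta> + (LINT t|lborel. \<bar>f'' t\<bar>))"
proof -
  note si = weyl_integrable[OF \<beta> int(1) bnd(1)]
  note d1 = weyl_integral_diff[OF si si, of "x + \<delta>" x]
  have s': "set_integrable lborel {0..} (\<lambda>t. (\<delta> * f' (x - t)) * t powr (\<beta> - 1))"
    using set_integrable_mult_right[OF weyl_integrable[OF \<beta> int(2) bnd(2), of x], of \<delta>] by (simp add: mult.assoc)
  note d2 = weyl_integral_diff[OF d1(1) s']
  have "\<bar>LINT t:{0..}|lborel. (f (x + \<delta> - t) - f (x - t) - \<delta> * f' (x - t)) * t powr (\<beta> - 1)\<bar>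
      \<le> \<bar>\<delta>\<bar> * (max 0 \<delta> - min 0 \<delta>) * (M / \<beta> + (LINT t|lborel. \<bar>f'' t\<bar>))"
  proof (rule weyl_remainder_bound[OF \<beta> int(3) bnd(3) d2(1)])
    fix t
    define z where "z = x - t"
    (* The mean value theorem turns the Taylor remainder of f into an increment of f', which is an
       integral of f'' over the range of \<delta>. *)
    obtain \<xi> where \<xi>: "min 0 \<delta> \<le> \<xi>" "\<xi> \<le> max 0 \<delta>" "f (z + \<delta>) - f z = \<delta> * f' (z + \<xi>)"
    proof (cases \<delta> "0 :: real" rule: linorder_cases)
      case less
      then obtain y where "z + \<delta> < y" "y < z" "f z - f (z + \<delta>) = (z - (z + \<delta>)) * f' y"
        using MVT2[of "z + \<delta>" z f f'] der(1) by auto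
      then show ?thesis using less by (intro that[of "y - z"]) (auto simp: algebra_simps)
    next
      case equal
      then show ?thesis by (intro that[of 0]) auto
    next
      case greater
      then obtain y where "z < y" "y < z + \<delta>" "f (z + \<delta>) - f z = ((z + \<delta>) - z) * f' y"
        using MVT2[of z "z + \<delta>" f f'] der(1) by auto
      then show ?thesis using greater by (intro that[of "y - z"]) auto
    qed
    have "\<bar>f (z + \<delta>) - f z - \<delta> * f' z\<bar> = \<bar>\<delta>\<bar> * \<bar>f' (z + \<xi>) - f' z\<bar>"
      unfolding \<xi>(3) by (simp add: abs_mult flip: right_diff_distrib)
    then have "ennreal \<bar>f (z + \<delta>) - f z - \<delta> * f' z\<bar> = ennreal \<bar>\<delta>\<bar> * ennreal \<bar>f' (z + \<xi>) - f' z\<bar>"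
      by (simp add: ennreal_mult)
    also have "\<dots> \<le> ennreal \<bar>\<delta>\<bar> * (\<integral>\<^sup>+r. ennreal (indicator {min 0 \<delta>..max 0 \<delta>} r * \<bar>f'' (z + r)\<bar>) \<partial>lborel)"
      using \<xi> by (intro mult_left_mono increment_le_nn_integral[OF der(2) int(3)]) auto
    finally show "ennreal \<bar>f (x + \<delta> - t) - f (x - t) - \<delta> * f' (x - t)\<bar>
        \<le> ennreal \<bar>\<delta>\<bar> * (\<integral>\<^sup>+r. ennreal (indicator {min 0 \<delta>..max 0 \<delta>} r * \<bar>f'' (x - t + r)\<bar>) \<partial>lborel)"
      by (simp add: z_def algebra_simps)
  qed auto
  moreover have "\<bar>\<delta>\<bar> * (max 0 \<delta> - min 0 \<delta>) = \<delta>\<^sup>2" by (auto simp: max_def min_def power2_eq_square)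
  moreover have "(LINT t:{0..}|lborel. (f (x + \<delta> - t) - f (x - t) - \<delta> * f' (x - t)) * t powr (\<beta> - 1))
      = weyl_integral \<beta> f (x + \<delta>) - weyl_integral \<beta> f x - \<delta> * weyl_integral \<beta> f' x"
    unfolding d2(2) d1(2) weyl_integral_def by (simp add: mult.assoc)
  ultimately show ?thesis by simp
qed

text \<open>The quadratic remainder makes the difference quotients converge. Applied twice, this gives the Liouville derivative of \<open>u\<close>
  as the Weyl integral of \<open>u''\<close>.\<close>

lemma weyl_integral_has_derivative:
  fixes f f' f'' :: "real \<Rightarrow> real"
  assumes "0 < \<beta>" "\<beta> < 1"
    and "\<And>t. (f has_real_derivative f' t) (at t)" "\<And>t. (f' has_real_derivative f'' t) (at t)"
    and "integrable lborel f" "integrable lborel f'" "integrable lborel f''"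
    and "\<And>t. \<bar>f t\<bar> \<le> M0" "\<And>t. \<bar>f' t\<bar> \<le> M1" "\<And>t. \<bar>f'' t\<bar> \<le> M"
  shows "(weyl_integral \<beta> f has_real_derivative weyl_integral \<beta> f' x) (at x)"
proof -
  define C where "C = M / \<beta> + (LINT t|lborel. \<bar>f'' t\<bar>)"
  let ?J = "weyl_integral \<beta> f" and ?J' = "weyl_integral \<beta> f' x"
  have "(\<lambda>\<delta>. (?J (x + \<delta>) - ?J x) / \<delta> - ?J') \<midarrow>0\<rightarrow> 0"
  proof (rule Lim_null_comparison)
    show "\<forall>\<^sub>F \<delta> in at 0. norm ((?J (x + \<delta>) - ?J x) / \<delta> - ?J') \<le> \<bar>\<delta>\<bar> * C"
    proof (rule eventually_at_filter[THEN iffD2], rule always_eventually, intro allI impI)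
      fix \<delta> :: real assume "\<delta> \<noteq> 0"
      then have "\<bar>\<delta>\<bar> * \<bar>(?J (x + \<delta>) - ?J x) / \<delta> - ?J'\<bar> = \<bar>?J (x + \<delta>) - ?J x - \<delta> * ?J'\<bar>"
      proof -
        have "?J (x + \<delta>) - ?J x - \<delta> * ?J' = \<delta> * ((?J (x + \<delta>) - ?J x) / \<delta> - ?J')"
          using \<open>\<delta> \<noteq> 0\<close> by (simp add: field_simps)
        then show ?thesis by (simp only: abs_mult)
      qed
      also have "\<dots> \<le> \<bar>\<delta>\<bar> * (\<bar>\<delta>\<bar> * C)"
        using weyl_integral_taylor[OF assms, of x \<delta>] by (simp add: C_def power2_eq_square mult.assoc[symmetric])
      finally show "norm ((?J (x + \<delta>) - ?J x) / \<delta> - ?J') \<le> \<bar>\<delta>\<bar> * C"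
        using \<open>\<delta> \<noteq> 0\<close> by simp
    qed
    show "(\<lambda>\<delta>. \<bar>\<delta>\<bar> * C) \<midarrow>0\<rightarrow> 0"
      by (auto intro!: tendsto_eq_intros)
  qed
  then show ?thesis
    unfolding DERIV_def by (rule LIM_zero_cancel)
qed

section \<open>From first to second order\<close>

text \<open>The unit-step result, applied to \<open>t \<mapsto> u (x - h * t)\<close>. Each derivative contributes a factor \<open>- h\<close> and the rescaling of the kernel a
  factor \<open>h powr (- \<beta>)\<close>; relative to \<open>h powr \<alpha>\<close> this leaves \<open>h\<close> for the first-order term and
  \<open>h ^ 2\<close> for the error.\<close>

lemma grunwald_expansion:
  fixes U :: "nat \<Rightarrow> real \<Rightarrow> real"
  assumes \<alpha>: "1 < \<alpha>" "\<alpha> < 2"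
    and der: "\<And>i t. i < 4 \<Longrightarrow> (U i has_real_derivative U (Suc i) t) (at t)"
    and int: "\<And>i. i \<le> 4 \<Longrightarrow> integrable lborel (U i)"
    and bnd: "\<And>i t. i \<le> 4 \<Longrightarrow> \<bar>U i t\<bar> \<le> M"
  obtains C where "C \<ge> 0" and "\<And>h x. h > 0 \<Longrightarrow>
     \<bar>(\<Sum>l. rising (- \<alpha>) l * U 0 (x - real l * h)) / h powr \<alpha>
        - (weyl_integral (2 - \<alpha>) (U 2) x / Gamma (2 - \<alpha>) - \<alpha> / 2 * h * (weyl_integral (2 - \<alpha>) (U 3) x / Gamma (2 - \<alpha>)))\<bar> \<le> C * h\<^sup>2"
proof -
  define \<beta> where "\<beta> = 2 - \<alpha>"
  have \<beta>: "0 < \<beta>" "\<beta> < 1" using \<alpha> by (auto simp: \<beta>_def)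
  have M0: "M \<ge> 0" using bnd[of 0 0] by linarith
  obtain K where K: "K \<ge> 0" "\<And>n \<tau>. 0 \<le> \<tau> \<Longrightarrow> \<tau> \<le> 1 \<Longrightarrow> real n + \<tau> > 0 \<Longrightarrow> \<bar>kernel_error \<beta> n \<tau>\<bar> \<le> K * (n + \<tau>) powr (\<beta> - 1)"
    using kernel_error_bound[OF \<beta>] by blast
  define C where "C = K * (M / \<beta> + (LINT t|lborel. \<bar>U 4 t\<bar>))"
  have G: "Gamma \<beta> > 0" using \<beta> by (auto intro: Gamma_real_pos)
  show thesis
  proof (rule that[of C])
    show "C \<ge> 0" unfolding C_def using K(1) M0 \<beta> by (intro mult_nonneg_nonneg add_nonneg_nonneg) auto
  next
    fix h x :: real assume h: "h > 0"
    (* Reading u backwards from x in steps of length h makes the step 1 and moves the powers of h into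
       the derivatives. *)
    define v where "v = (\<lambda>i t. (- h) ^ i * U i (x - h * t))"
    let ?J = "\<lambda>i. weyl_integral \<beta> (U i) x"
    let ?g = "\<lambda>i t. U i (x - h * t)"
    have hp: "h\<^sup>2 * h powr (- \<beta>) = h powr \<alpha>"
      using h by (simp add: \<beta>_def powr_diff powr_minus field_simps flip: powr_numeral)
    have gi: "integrable lborel (?g i)" if "i \<le> 4" for i
      using lborel_integrable_real_affine[OF int[OF that], of "- h" x] h by simp
    have gk: "set_integrable lborel {0..} (\<lambda>t. ?g i t * t powr (\<beta> - 1))" if "i \<le> 4" for i
      by (rule kernel_product_integrable(1)[OF \<beta> gi[OF that]]) (rule bnd[OF that])
    have sum: "summable (\<lambda>l. rising (\<beta> - 2) l * v 0 (real l))"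
    proof (rule summable_comparison_test'[of "\<lambda>l. M * \<bar>rising (- \<alpha>) l\<bar>" 0])
      show "summable (\<lambda>l. M * \<bar>rising (- \<alpha>) l\<bar>)" by (intro summable_mult abs_summable_rising \<alpha>)
      show "norm (rising (\<beta> - 2) l * v 0 (real l)) \<le> M * \<bar>rising (- \<alpha>) l\<bar>" for l
        using mult_right_mono[OF bnd[of 0 "x - h * l"], of "\<bar>rising (- \<alpha>) l\<bar>"]
        by (simp add: v_def \<beta>_def abs_mult mult.commute)
    qed
    have approx: "\<bar>(LINT t:{0..}|lborel. (v 2 t + (2 - \<beta>) / 2 * v 3 t) * t powr (\<beta> - 1)) / Gamma \<beta>
      - (\<Sum>l. rising (\<beta> - 2) l * v 0 (real l))\<bar> \<le> K * (LINT t:{0..}|lborel. \<bar>v 4 t\<bar> * t powr (\<beta> - 1))"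
    proof (rule grunwald_unit_step[where M = "h ^ 4 * M", OF \<beta> K(1)])
      fix i :: nat and t assume "i < 4"
      have "((\<lambda>t. U i (x - h * t)) has_real_derivative U (Suc i) (x - h * t) * (- h)) (at t)"
        by (rule DERIV_chain2[OF der[OF \<open>i < 4\<close>]]) (auto intro!: derivative_eq_intros)
      from DERIV_cmult[OF this, of "(- h) ^ i"]
      show "(v i has_real_derivative v (Suc i) t) (at t)" by (simp add: v_def mult_ac)
    next
      fix i :: nat assume "i \<le> 4"
      then show "integrable lborel (v i)" unfolding v_def by (intro integrable_mult_right) (rule gi)
    next
      show "\<bar>v 4 t\<bar> \<le> h ^ 4 * M" for t
        using mult_left_mono[OF bnd[of 4 "x - h * t"], of "h ^ 4"] by (simp add: v_def abs_mult)
    qed (use sum K(2) in auto)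
    have lhs: "(LINT t:{0..}|lborel. (v 2 t + (2 - \<beta>) / 2 * v 3 t) * t powr (\<beta> - 1))
        = h powr \<alpha> * (?J 2 - \<alpha> / 2 * h * ?J 3)"
    proof -
      have "(LINT t:{0..}|lborel. (v 2 t + (2 - \<beta>) / 2 * v 3 t) * t powr (\<beta> - 1))
        = (LINT t:{0..}|lborel. h\<^sup>2 * (?g 2 t * t powr (\<beta> - 1)) - \<alpha> / 2 * h ^ 3 * (?g 3 t * t powr (\<beta> - 1)))"
        by (simp add: v_def \<beta>_def algebra_simps)
      also have "\<dots> = h\<^sup>2 * (LINT t:{0..}|lborel. ?g 2 t * t powr (\<beta> - 1)) - \<alpha> / 2 * h ^ 3 * (LINT t:{0..}|lborel. ?g 3 t * t powr (\<beta> - 1))"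
        using gk[of 2] gk[of 3] by (subst set_integral_diff) auto
      also have "\<dots> = (h\<^sup>2 * h powr (- \<beta>)) * (?J 2 - \<alpha> / 2 * h * ?J 3)"
        unfolding weyl_integral_scale[OF h] by (simp add: algebra_simps power2_eq_square power3_eq_cube)
      finally show ?thesis by (simp only: hp)
    qed
    have "(LINT t:{0..}|lborel. \<bar>v 4 t\<bar> * t powr (\<beta> - 1)) \<le> h powr \<alpha> * (h\<^sup>2 * (M / \<beta> + (LINT t|lborel. \<bar>U 4 t\<bar>)))"
    proof -
      have "(LINT t:{0..}|lborel. \<bar>v 4 t\<bar> * t powr (\<beta> - 1)) = h ^ 4 * (LINT t:{0..}|lborel. \<bar>?g 4 t\<bar> * t powr (\<beta> - 1))"
        by (simp add: v_def abs_mult mult.assoc)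
      also have "\<dots> = (h\<^sup>2 * h powr (- \<beta>)) * (h\<^sup>2 * weyl_integral \<beta> (\<lambda>t. \<bar>U 4 t\<bar>) x)"
        using weyl_integral_scale[OF h, of "\<lambda>t. \<bar>U 4 t\<bar>" x \<beta>] by (simp add: algebra_simps eval_nat_numeral)
      also have "\<dots> = h powr \<alpha> * (h\<^sup>2 * weyl_integral \<beta> (\<lambda>t. \<bar>U 4 t\<bar>) x)" by (simp only: hp)
      also have "\<dots> \<le> h powr \<alpha> * (h\<^sup>2 * (M / \<beta> + (LINT t|lborel. \<bar>U 4 t\<bar>)))"
        using int[of 4] bnd[of 4] by (intro mult_left_mono weyl_integral_abs_le \<beta>) auto
      finally show ?thesis .
    qed
    then have rhs: "K * (LINT t:{0..}|lborel. \<bar>v 4 t\<bar> * t powr (\<beta> - 1)) \<le> h powr \<alpha> * (C * h\<^sup>2)"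
      using mult_left_mono[OF _ K(1)] by (fastforce simp: C_def mult_ac)
    have *: "\<bar>h powr \<alpha> * (?J 2 - \<alpha> / 2 * h * ?J 3) / Gamma \<beta> - (\<Sum>l. rising (\<beta> - 2) l * v 0 (real l))\<bar>
        \<le> h powr \<alpha> * (C * h\<^sup>2)"
      using order_trans[OF approx rhs] unfolding lhs .
    define S where "S = (\<Sum>l. rising (- \<alpha>) l * U 0 (x - real l * h))"
    have S: "(\<Sum>l. rising (\<beta> - 2) l * v 0 (real l)) = S" by (simp add: S_def v_def \<beta>_def mult.commute)
    define Y where "Y = (?J 2 - \<alpha> / 2 * h * ?J 3) / Gamma \<beta>"
    have "h powr \<alpha> * \<bar>S / h powr \<alpha> - Y\<bar> = \<bar>h powr \<alpha> * (S / h powr \<alpha> - Y)\<bar>"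
      by (simp add: abs_mult)
    also have "h powr \<alpha> * (S / h powr \<alpha> - Y) = S - h powr \<alpha> * Y" using h by (simp add: right_diff_distrib)
    also have "\<bar>S - h powr \<alpha> * Y\<bar> \<le> h powr \<alpha> * (C * h\<^sup>2)" using * unfolding S Y_def by (simp add: abs_minus_commute)
    finally have "\<bar>S / h powr \<alpha> - Y\<bar> \<le> C * h\<^sup>2" using h by simp
    then show "\<bar>(\<Sum>l. rising (- \<alpha>) l * U 0 (x - real l * h)) / h powr \<alpha>
        - (weyl_integral (2 - \<alpha>) (U 2) x / Gamma (2 - \<alpha>) - \<alpha> / 2 * h * (weyl_integral (2 - \<alpha>) (U 3) x / Gamma (2 - \<alpha>)))\<bar> \<le> C * h\<^sup>2"
      unfolding S_def[symmetric] Y_def \<beta>_def by (simp add: diff_divide_distrib)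
  qed
qed

text \<open>Averaging a first-order formula \<open>G\<close> over shifted points with the weights \<open>correction \<alpha>\<close>: at the point shifted by
  \<open>(1 - m) * h\<close> the term of first order is \<open>(1 - m - \<alpha> / 2) * h * D1 x\<close>, and the weighted mean of its coefficient is 0. The
  second moment of the weights controls the remainders.\<close>

lemma correction_raises_order:
  fixes D0 D1 :: "real \<Rightarrow> real" and G :: "real \<Rightarrow> real"
  assumes \<alpha>: "1 < \<alpha>" "\<alpha> < 2" and h: "h > 0"
    and nonneg: "C \<ge> 0" "C2 \<ge> 0" "C3 \<ge> 0"
    and G: "\<And>y. \<bar>G y - (D0 y - \<alpha> / 2 * h * D1 y)\<bar> \<le> C * h\<^sup>2"
    and D0: "\<And>\<delta>. \<bar>D0 (x + \<delta>) - D0 x - \<delta> * D1 x\<bar> \<le> \<delta>\<^sup>2 * C2"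
    and D1: "\<And>\<delta>. \<bar>D1 (x + \<delta>) - D1 x\<bar> \<le> \<bar>\<delta>\<bar> * C3"
  shows "summable (\<lambda>m. correction \<alpha> m * G (x + (1 - real m) * h))"
    and "\<bar>(\<Sum>m. correction \<alpha> m * G (x + (1 - real m) * h)) - D0 x\<bar>
      \<le> (C + C2 + C3) * (\<Sum>m. (1 + (real m)\<^sup>2) * \<bar>correction \<alpha> m\<bar>) * h\<^sup>2"
proof -
  note mom = correction_moments[OF \<alpha>]
  (* The coefficient 1 - m - \<alpha> / 2 of h * D1 x has weighted mean 0, so only the errors E m survive. *)
  define E where "E = (\<lambda>m. G (x + (1 - real m) * h) - D0 x - (1 - real m - \<alpha> / 2) * h * D1 x)"
  have E: "\<bar>E m\<bar> \<le> (C + C2 + C3) * h\<^sup>2 * (1 + (real m)\<^sup>2)" for m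
  proof -
    define \<delta> where "\<delta> = (1 - real m) * h"
    define s where "s = 1 + (real m)\<^sup>2"
    have s: "1 \<le> s" "(1 - real m)\<^sup>2 \<le> s" "\<bar>1 - real m\<bar> \<le> s"
    proof -
      show "1 \<le> s" by (simp add: s_def)
      show "(1 - real m)\<^sup>2 \<le> s" by (simp add: s_def power2_eq_square algebra_simps)
      have "real m \<le> (real m)\<^sup>2" by (cases m) (auto simp: power2_eq_square)
      then show "\<bar>1 - real m\<bar> \<le> s" unfolding s_def by linarith
    qed
    have "E m = (G (x + \<delta>) - (D0 (x + \<delta>) - \<alpha> / 2 * h * D1 (x + \<delta>))) + (D0 (x + \<delta>) - D0 x - \<delta> * D1 x)
        - \<alpha> / 2 * (h * (D1 (x + \<delta>) - D1 x))"
      by (simp add: E_def \<delta>_def algebra_simps)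
    moreover have "\<bar>G (x + \<delta>) - (D0 (x + \<delta>) - \<alpha> / 2 * h * D1 (x + \<delta>))\<bar> \<le> C * h\<^sup>2 * s"
    proof -
      have "C * h\<^sup>2 * 1 \<le> C * h\<^sup>2 * s" using s nonneg by (intro mult_left_mono) auto
      then show ?thesis using G[of "x + \<delta>"] by linarith
    qed
    moreover have "\<bar>D0 (x + \<delta>) - D0 x - \<delta> * D1 x\<bar> \<le> C2 * h\<^sup>2 * s"
    proof -
      have "\<delta>\<^sup>2 * C2 = C2 * h\<^sup>2 * (1 - real m)\<^sup>2" by (simp add: \<delta>_def power_mult_distrib)
      also have "\<dots> \<le> C2 * h\<^sup>2 * s" using s nonneg by (intro mult_left_mono) auto
      finally show ?thesis using D0[of \<delta>] by linarith
    qed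
    moreover have "\<bar>\<alpha> / 2 * (h * (D1 (x + \<delta>) - D1 x))\<bar> \<le> C3 * h\<^sup>2 * s"
    proof -
      have "\<bar>\<alpha> / 2 * (h * (D1 (x + \<delta>) - D1 x))\<bar> = (\<alpha> / 2) * (h * \<bar>D1 (x + \<delta>) - D1 x\<bar>)"
        using \<alpha> h by (simp add: abs_mult)
      also have "\<dots> \<le> 1 * (h * (\<bar>\<delta>\<bar> * C3))"
        using \<alpha> h D1[of \<delta>] by (intro mult_mono) auto
      also have "\<dots> = C3 * h\<^sup>2 * \<bar>1 - real m\<bar>" using h by (simp add: \<delta>_def abs_mult power2_eq_square)
      also have "\<dots> \<le> C3 * h\<^sup>2 * s" using s nonneg by (intro mult_left_mono) auto
      finally show ?thesis .
    qed
    ultimately have "\<bar>E m\<bar> \<le> C * h\<^sup>2 * s + C2 * h\<^sup>2 * s + C3 * h\<^sup>2 * s" by linarith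
    then show ?thesis by (simp add: s_def algebra_simps)
  qed
  have bE: "\<bar>correction \<alpha> m * E m\<bar> \<le> (C + C2 + C3) * h\<^sup>2 * ((1 + (real m)\<^sup>2) * \<bar>correction \<alpha> m\<bar>)" for m
    using mult_left_mono[OF E, of "\<bar>correction \<alpha> m\<bar>" m] by (simp add: abs_mult mult_ac)
  have sE: "summable (\<lambda>m. \<bar>correction \<alpha> m * E m\<bar>)"
    by (rule summable_comparison_test'[OF summable_mult[OF mom(3), of "(C + C2 + C3) * h\<^sup>2"], of 0]) (use bE in auto)
  have "(\<lambda>m. correction \<alpha> m * E m + correction \<alpha> m * D0 x
        + (correction \<alpha> m * ((1 - \<alpha> / 2) * h * D1 x) - (real m * correction \<alpha> m) * (h * D1 x)))
      sums ((\<Sum>m. correction \<alpha> m * E m) + 1 * D0 x + (1 * ((1 - \<alpha> / 2) * h * D1 x) - (1 - \<alpha> / 2) * (h * D1 x)))"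
    by (intro sums_add sums_diff sums_mult2 mom(1,2) summable_sums summable_rabs_cancel[OF sE])
  moreover have "correction \<alpha> m * E m + correction \<alpha> m * D0 x
        + (correction \<alpha> m * ((1 - \<alpha> / 2) * h * D1 x) - (real m * correction \<alpha> m) * (h * D1 x))
      = correction \<alpha> m * G (x + (1 - real m) * h)" for m
    by (simp add: E_def algebra_simps)
  ultimately have sums: "(\<lambda>m. correction \<alpha> m * G (x + (1 - real m) * h)) sums ((\<Sum>m. correction \<alpha> m * E m) + D0 x)"
    by simp
  then show "summable (\<lambda>m. correction \<alpha> m * G (x + (1 - real m) * h))" by (rule sums_summable)
  have "\<bar>\<Sum>m. correction \<alpha> m * E m\<bar> \<le> (\<Sum>m. \<bar>correction \<alpha> m * E m\<bar>)"
    by (rule summable_rabs[OF sE])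
  also have "\<dots> \<le> (\<Sum>m. (C + C2 + C3) * h\<^sup>2 * ((1 + (real m)\<^sup>2) * \<bar>correction \<alpha> m\<bar>))"
    by (intro suminf_le bE sE summable_mult mom(3))
  also have "\<dots> = (C + C2 + C3) * h\<^sup>2 * (\<Sum>m. (1 + (real m)\<^sup>2) * \<bar>correction \<alpha> m\<bar>)"
    by (rule suminf_mult[OF mom(3)])
  finally show "\<bar>(\<Sum>m. correction \<alpha> m * G (x + (1 - real m) * h)) - D0 x\<bar>
      \<le> (C + C2 + C3) * (\<Sum>m. (1 + (real m)\<^sup>2) * \<bar>correction \<alpha> m\<bar>) * h\<^sup>2"
    using sums by (simp add: sums_iff mult_ac)
qed

text \<open>All rearrangements are legitimate because the double series converges absolutely.\<close>

lemma cauchy_convolution_sums: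
  fixes b g w :: "nat \<Rightarrow> real"
  assumes b: "summable (\<lambda>m. \<bar>b m\<bar>)" and g: "summable (\<lambda>j. \<bar>g j\<bar>)" and w: "\<And>k. \<bar>w k\<bar> \<le> M"
  shows "(\<lambda>l. (\<Sum>m\<le>l. b m * g (l - m)) * w l) sums (\<Sum>m. b m * (\<Sum>j. g j * w (m + j)))"
proof -
  define F where "F = (\<lambda>(m, j). b m * g j * w (m + j))"
  have M: "M \<ge> 0" using w[of 0] by linarith
  have Fle: "\<bar>F (m, j)\<bar> \<le> \<bar>b m\<bar> * M * \<bar>g j\<bar>" for m j
    using mult_left_mono[OF w[of "m + j"], of "\<bar>b m\<bar> * \<bar>g j\<bar>"] by (simp add: F_def abs_mult mult_ac)
  have gs: "(\<lambda>j. \<bar>g j\<bar>) summable_on UNIV"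
    using g by (simp add: summable_on_UNIV_nonneg_real_iff)
  have inner: "summable (\<lambda>j. \<bar>F (m, j)\<bar>)" for m
    by (rule summable_comparison_test'[OF summable_mult[OF g, of "\<bar>b m\<bar> * M"], of 0]) (use Fle in auto)
  then have inner': "(\<lambda>j. \<bar>F (m, j)\<bar>) summable_on UNIV" for m
    by (simp add: summable_on_UNIV_nonneg_real_iff)
  have outer: "infsum (\<lambda>j. \<bar>F (m, j)\<bar>) UNIV \<le> (M * infsum (\<lambda>j. \<bar>g j\<bar>) UNIV) * \<bar>b m\<bar>" for m
  proof -
    have "infsum (\<lambda>j. \<bar>F (m, j)\<bar>) UNIV \<le> infsum (\<lambda>j. (\<bar>b m\<bar> * M) * \<bar>g j\<bar>) UNIV"
      using inner' Fle by (intro infsum_mono summable_on_cmult_right gs) auto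
    then show ?thesis by (simp add: infsum_cmult_right' mult_ac)
  qed
  have "(\<lambda>p. norm (F p)) summable_on (UNIV \<times> UNIV)"
  proof (rule Infinite_Sum.abs_summable_on_Sigma_iff[THEN iffD2], intro conjI ballI)
    show "(\<lambda>j. norm (F (m, j))) summable_on UNIV" for m using inner' by simp
    have "summable (\<lambda>m. infsum (\<lambda>j. \<bar>F (m, j)\<bar>) UNIV)"
      by (rule summable_comparison_test'[OF summable_mult[OF b], of 0]) (use outer in \<open>auto simp: infsum_nonneg\<close>)
    then show "(\<lambda>m. norm (infsum (\<lambda>j. norm (F (m, j))) UNIV)) summable_on UNIV"
      by (simp add: summable_on_UNIV_nonneg_real_iff infsum_nonneg)
  qed
  then obtain S where S: "(F has_sum S) (UNIV \<times> UNIV)"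
    using Infinite_Sum.abs_summable_summable summable_on_def by blast
  have "((\<lambda>m. b m * (\<Sum>j. g j * w (m + j))) has_sum S) UNIV"
  proof (rule has_sum_SigmaD[OF S])
    fix m
    have gw: "summable (\<lambda>j. \<bar>g j * w (m + j)\<bar>)"
    proof (rule summable_comparison_test'[OF summable_mult[OF g, of M], of 0])
      show "norm \<bar>g j * w (m + j)\<bar> \<le> M * \<bar>g j\<bar>" for j
        using mult_right_mono[OF w[of "m + j"], of "\<bar>g j\<bar>"] by (simp add: abs_mult mult.commute)
    qed
    have "(\<lambda>j. b m * (g j * w (m + j))) sums (b m * (\<Sum>j. g j * w (m + j)))"
      using summable_rabs_cancel[OF gw] by (intro sums_mult summable_sums)
    then show "((\<lambda>j. F (m, j)) has_sum b m * (\<Sum>j. g j * w (m + j))) UNIV"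
      using inner[of m] by (intro norm_summable_imp_has_sum) (auto simp: F_def mult.assoc)
  qed
  then have S_eq: "S = (\<Sum>m. b m * (\<Sum>j. g j * w (m + j)))"
    using has_sum_imp_sums sums_unique by blast
  have "((\<lambda>(l, m). b m * g (l - m) * w l) has_sum S) (SIGMA l:UNIV. {..l})"
  proof (rule has_sum_reindex_bij_witness[where i = "\<lambda>(m, j). (m + j, m)" and j = "\<lambda>(l, m). (m, l - m)", THEN iffD2])
    show "(F has_sum S) (UNIV \<times> UNIV)" by (rule S)
  qed (auto simp: F_def)
  then have "((\<lambda>l. \<Sum>m\<le>l. b m * g (l - m) * w l) has_sum S) UNIV"
    by (rule has_sum_SigmaD) (auto intro!: has_sum_finiteI)
  then show ?thesis
    unfolding S_eq by (auto dest: has_sum_imp_sums simp: sum_distrib_right)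
qed

text \<open>By the Cauchy product, \<open>B2\<close> is the Grunwald formula, applied at the points shifted by \<open>(1 - m) * h\<close> and averaged.\<close>

lemma B2_eq_corrected_grunwald:
  fixes u :: "real \<Rightarrow> real"
  assumes \<alpha>: "1 < \<alpha>" "\<alpha> < 2" and h: "h > 0" and u: "\<And>t. \<bar>u t\<bar> \<le> M"
  defines "G \<equiv> \<lambda>y. (\<Sum>l. rising (- \<alpha>) l * u (y - real l * h)) / h powr \<alpha>"
  assumes sum: "summable (\<lambda>m. correction \<alpha> m * G (x + (1 - real m) * h))"
  shows "summable (\<lambda>l. kappa2 \<alpha> l * u (x - (real l - 1) * h))"
    and "B2 \<alpha> h u x = (\<Sum>m. correction \<alpha> m * G (x + (1 - real m) * h))"
proof -
  define w where "w = (\<lambda>k. u (x - (real k - 1) * h))"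
  have "(\<lambda>l. (\<Sum>m\<le>l. correction \<alpha> m * rising (- \<alpha>) (l - m)) * w l)
      sums (\<Sum>m. correction \<alpha> m * (\<Sum>j. rising (- \<alpha>) j * w (m + j)))"
    by (rule cauchy_convolution_sums[OF abs_summable_correction[OF \<alpha>] abs_summable_rising[OF \<alpha>], of w M]) (simp add: w_def u)
  moreover have "(\<Sum>j. rising (- \<alpha>) j * w (m + j)) = h powr \<alpha> * G (x + (1 - real m) * h)" for m
    using h by (simp add: G_def w_def algebra_simps)
  ultimately have sums: "(\<lambda>l. kappa2 \<alpha> l * w l) sums (\<Sum>m. correction \<alpha> m * (h powr \<alpha> * G (x + (1 - real m) * h)))"
    by (simp add: kappa2_eq[OF \<alpha>])
  then show "summable (\<lambda>l. kappa2 \<alpha> l * u (x - (real l - 1) * h))"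
    by (auto simp: w_def dest: sums_summable)
  have "(\<Sum>m. correction \<alpha> m * (h powr \<alpha> * G (x + (1 - real m) * h)))
      = h powr \<alpha> * (\<Sum>m. correction \<alpha> m * G (x + (1 - real m) * h))"
    using suminf_mult[OF sum, of "h powr \<alpha>"] by (simp add: mult.left_commute)
  then show "B2 \<alpha> h u x = (\<Sum>m. correction \<alpha> m * G (x + (1 - real m) * h))"
    using sums h by (simp add: B2_def w_def sums_iff)
qed

theorem theorem1:
  fixes \<alpha> :: real and u :: "real \<Rightarrow> real"
  assumes "1 < \<alpha>" and "\<alpha> < 2"
    and "Ck_real (nat \<lfloor>\<alpha>\<rfloor> + 3) u"
    and "\<forall>k < nat \<lfloor>\<alpha>\<rfloor> + 4. \<forall>x. (deriv ^^ k) u field_differentiable at x"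
    and "\<forall>k \<le> nat \<lfloor>\<alpha>\<rfloor> + 4. integrable lborel ((deriv ^^ k) u)"
  shows "RL_deriv_exists \<alpha> u \<and>
         (\<forall>h>0. \<forall>x. summable (\<lambda>l. kappa2 \<alpha> l * u (x - (real l - 1) * h))) \<and>
         (\<exists>C. \<forall>\<^sub>F h in at_right 0. \<forall>x. \<bar>RL_deriv \<alpha> u x - B2 \<alpha> h u x\<bar> \<le> C * h ^ 2)"
proof -
  note \<alpha> = assms(1,2)
  define \<beta> where "\<beta> = 2 - \<alpha>"
  have \<beta>: "0 < \<beta>" "\<beta> < 1" using \<alpha> by (auto simp: \<beta>_def)
  have "\<lfloor>\<alpha>\<rfloor> = 1" using \<alpha> by (simp add: floor_eq_iff)
  define U where "U = (\<lambda>i. (deriv ^^ i) u)"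
  have U0: "U 0 = u" by (simp add: U_def)
  have der: "(U i has_real_derivative U (Suc i) t) (at t)" if "i < 5" for i t
    using assms(4) that \<open>\<lfloor>\<alpha>\<rfloor> = 1\<close> by (simp add: U_def field_differentiable_derivI)
  have int: "integrable lborel (U i)" if "i \<le> 5" for i
    using assms(5) that \<open>\<lfloor>\<alpha>\<rfloor> = 1\<close> by (simp add: U_def)
  (* One bound for u and its first four derivatives; it comes from the integrability of the next one. *)
  define N where "N = (\<lambda>i. LINT t|lborel. \<bar>U i t\<bar> + \<bar>U (Suc i) t\<bar>)"
  define M where "M = Max (N ` {..4})"
  have bnd: "\<bar>U i t\<bar> \<le> M" if "i \<le> 4" for i t
  proof -
    have "\<bar>U i t\<bar> \<le> N i" unfolding N_def using that by (intro abs_value_le_L1_norms der int) auto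
    also have "N i \<le> M" unfolding M_def using that by (intro Max_ge) auto
    finally show ?thesis .
  qed
  have M0: "M \<ge> 0" using bnd[of 0 0] by linarith
  have G: "Gamma \<beta> > 0" using \<beta> by (auto intro: Gamma_real_pos)
  have der': "(U 0 has_real_derivative U 1 t) (at t)" "(U 1 has_real_derivative U 2 t) (at t)"
     "(U 2 has_real_derivative U 3 t) (at t)" "(U 3 has_real_derivative U 4 t) (at t)" for t
    using der[of 0 t] der[of 1 t] der[of 2 t] der[of 3 t] by (simp_all add: eval_nat_numeral)
  have bnd': "\<bar>U 0 t\<bar> \<le> M" "\<bar>U 1 t\<bar> \<le> M" "\<bar>U 2 t\<bar> \<le> M" "\<bar>U 3 t\<bar> \<le> M" "\<bar>U 4 t\<bar> \<le> M" for t
    by (simp_all add: bnd)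
  have int': "integrable lborel (U 0)" "integrable lborel (U 1)" "integrable lborel (U 2)"
     "integrable lborel (U 3)" "integrable lborel (U 4)"
    by (simp_all add: int)
  let ?J = "\<lambda>i. weyl_integral \<beta> (U i)"
  have J01: "(?J 0 has_real_derivative ?J 1 x) (at x)" for x
    by (rule weyl_integral_has_derivative[OF \<beta> der'(1,2) int'(1,2,3) bnd'(1,2,3)])
  have J12: "(?J 1 has_real_derivative ?J 2 x) (at x)" for x
    by (rule weyl_integral_has_derivative[OF \<beta> der'(2,3) int'(2,3,4) bnd'(2,3,4)])
  note liou = liouville_integral_eq_weyl[OF \<alpha> int'(1)[unfolded U0] bnd'(1)[unfolded U0]]
  have L: "liouville_integral \<alpha> u = ?J 0"
    using liou(1) by (auto simp: fun_eq_iff U0 \<beta>_def)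
  have dL: "deriv (?J 0) = ?J 1" "deriv (?J 1) = ?J 2"
    using J01 J12 by (auto simp: fun_eq_iff intro!: DERIV_imp_deriv)
  have exists: "RL_deriv_exists \<alpha> u"
    unfolding RL_deriv_exists_def L dL using liou(2) J01 J12 by (auto simp: field_differentiable_def)
  define D0 where "D0 = (\<lambda>x. ?J 2 x / Gamma \<beta>)"
  define D1 where "D1 = (\<lambda>x. ?J 3 x / Gamma \<beta>)"
  have RL: "RL_deriv \<alpha> u x = D0 x" for x
  proof -
    have "(deriv ^^ 2) (?J 0) = ?J 2" unfolding numeral_2_eq_2 funpow.simps o_def id_def dL[unfolded numeral_2_eq_2] ..
    then show ?thesis by (simp add: RL_deriv_def L D0_def flip: \<beta>_def)
  qed
  have "\<exists>C\<ge>0. \<forall>h>0. \<forall>x.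
     \<bar>(\<Sum>l. rising (- \<alpha>) l * u (x - real l * h)) / h powr \<alpha> - (D0 x - \<alpha> / 2 * h * D1 x)\<bar> \<le> C * h\<^sup>2"
  proof (rule grunwald_expansion[where U = U and M = M, OF \<alpha>])
    fix C
    assume "0 \<le> C" and "\<And>h x. 0 < h \<Longrightarrow> \<bar>(\<Sum>l. rising (- \<alpha>) l * U 0 (x - real l * h)) / h powr \<alpha>
      - (weyl_integral (2 - \<alpha>) (U 2) x / Gamma (2 - \<alpha>) - \<alpha> / 2 * h * (weyl_integral (2 - \<alpha>) (U 3) x / Gamma (2 - \<alpha>)))\<bar>
      \<le> C * h\<^sup>2"
    then show ?thesis unfolding D0_def D1_def \<beta>_def U0 by blast
  qed (simp_all add: der int bnd)
  then obtain C where C: "C \<ge> 0" and expansion: "\<And>h x. h > 0 \<Longrightarrow>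
     \<bar>(\<Sum>l. rising (- \<alpha>) l * u (x - real l * h)) / h powr \<alpha> - (D0 x - \<alpha> / 2 * h * D1 x)\<bar> \<le> C * h\<^sup>2"
    by blast
  define C2 where "C2 = (M / \<beta> + (LINT t|lborel. \<bar>U 4 t\<bar>)) / Gamma \<beta>"
  have taylor: "\<bar>D0 (x + \<delta>) - D0 x - \<delta> * D1 x\<bar> \<le> \<delta>\<^sup>2 * C2" for x \<delta>
  proof -
    have "\<bar>D0 (x + \<delta>) - D0 x - \<delta> * D1 x\<bar> = \<bar>?J 2 (x + \<delta>) - ?J 2 x - \<delta> * ?J 3 x\<bar> / Gamma \<beta>"
      using G by (simp add: D0_def D1_def flip: diff_divide_distrib)
    also have "\<dots> \<le> \<delta>\<^sup>2 * (M / \<beta> + (LINT t|lborel. \<bar>U 4 t\<bar>)) / Gamma \<beta>"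
      using G by (intro divide_right_mono weyl_integral_taylor[OF \<beta> der'(3,4) int'(3,4,5) bnd'(3,4,5)]) auto
    finally show ?thesis by (simp add: C2_def)
  qed
  have lipschitz: "\<bar>D1 (x + \<delta>) - D1 x\<bar> \<le> \<bar>\<delta>\<bar> * C2" for x \<delta>
  proof -
    have "\<bar>D1 (x + \<delta>) - D1 x\<bar> = \<bar>?J 3 (x + \<delta>) - ?J 3 x\<bar> / Gamma \<beta>"
      using G by (simp add: D1_def flip: diff_divide_distrib)
    also have "\<dots> \<le> \<bar>\<delta>\<bar> * (M / \<beta> + (LINT t|lborel. \<bar>U 4 t\<bar>)) / Gamma \<beta>"
      using G by (intro divide_right_mono weyl_integral_lipschitz[OF \<beta> der'(4) int'(4,5) bnd'(4,5)]) auto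
    finally show ?thesis by (simp add: C2_def)
  qed
  have C2: "C2 \<ge> 0"
    unfolding C2_def using M0 \<beta> G by (intro divide_nonneg_nonneg add_nonneg_nonneg) auto
  define K where "K = (C + C2 + C2) * (\<Sum>m. (1 + (real m)\<^sup>2) * \<bar>correction \<alpha> m\<bar>)"
  have main: "summable (\<lambda>l. kappa2 \<alpha> l * u (x - (real l - 1) * h))" "\<bar>RL_deriv \<alpha> u x - B2 \<alpha> h u x\<bar> \<le> K * h\<^sup>2"
    if h: "h > 0" for h x
  proof -
    note order2 = correction_raises_order[OF \<alpha> h C C2 C2 expansion[OF h] taylor lipschitz]
    note B2 = B2_eq_corrected_grunwald[OF \<alpha> h bnd'(1)[unfolded U0] order2(1)]
    show "summable (\<lambda>l. kappa2 \<alpha> l * u (x - (real l - 1) * h))" by (rule B2(1))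
    show "\<bar>RL_deriv \<alpha> u x - B2 \<alpha> h u x\<bar> \<le> K * h\<^sup>2"
      unfolding RL B2(2) K_def using order2(2)[of x] by (simp add: abs_minus_commute)
  qed
  have "\<forall>\<^sub>F h in at_right 0. \<forall>x. \<bar>RL_deriv \<alpha> u x - B2 \<alpha> h u x\<bar> \<le> K * h ^ 2"
    using main(2) by (auto simp: eventually_at_filter)
  with exists main(1) show ?thesis by blast
qed

end
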